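(* Let $f$ be a strongly $(\tau,\sigma)$-elastic cost function with tight elasticity constants $\sigma\ge\tau$, $\sigma>1$, let $\alpha=\alpha_\star^{(\sigma)}:=\sigma^{\sigma/(\sigma-1)}$, and let $\chi^{(\tau)}_-$ be the smaller positive root of $z^\tau-\frac{\alpha}{\tau-1}(z^{\tau-1}-1)$. For $\xi>0$ let $\phi_{\mathrm{lb},\xi}$ be the solution of $\phi'(y)=\alpha\cdot F(\phi(y),y)$ with $\phi(\xi)=\chi^{(\tau)}_-\xi$, where $F(\phi,y)=\frac{f'(\phi)-f'(y)}{\phi f''(\phi)}$. Then for every $\varepsilon>0$ and every $Y>0$ there exists $\xi>0$ such that $\phi_{\mathrm{lb},\xi}$ is $\alpha_\star^{(\sigma)}$-competitive on $[0,Y]$ and $$|\phi_{\mathrm{lb},\xi}(y)-\phi_{\mathrm{lb}}(y)|<\varepsilon\qquad\text{for all }y\in[0,Y].$$ Specifically, the reserve function $\phi_{\mathrm{lb},\xi}$ is $\alpha_\star^{(\sigma)}$-competitive on some interval that contains $[0,\chi^{(\tau)}_-\xi]$.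
   Context: Elasticity: $Eg(y)=yg'(y)/g(y)$. A cost $f:\mathbb{R}_+\to\mathbb{R}_+$ is $(\tau,\sigma)$-elastic if it is increasing, smooth, strictly convex, analytic at the origin, $f(0)=f'(0)=0$, $Ef'$ is non-decreasing on $(0,\infty)$, and $\tau-1\le Ef'\le\sigma-1$; strongly $(\tau,\sigma)$-elastic if in addition $\tau-2\le Ef''\le\sigma-2$ on $(0,\infty)$. The constants are tight if $\inf Ef'=\tau-1$, $\sup Ef'=\sigma-1$ (then $\tau>1$). A function $\phi$ is called ($\alpha$-)competitive on an interval $[0,Y]$ if there it satisfies the conditions characterizing $\alpha$-competitive reserve functions: $\phi(0)=0$ and, for $0<y\le Y$, $\phi'(y)=\alpha F(\phi(y),y)$, $\phi'(y)\ge0$, $\phi(y)\ge y$. Global feasible solutions are those satisfying this on all of $[0,\infty)$, and the lower-bound solution is $\phi_{\mathrm{lb}}(y)=\inf\{\phi(y):\phi\text{ a global feasible solution with }\phi'(0)=\chi^{(\tau)}_-\}$ (with $\alpha=\alpha_\star^{(\sigma)}$). *)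

theory Defs
  imports "HOL-Analysis.Analysis"
begin

definition elasticity :: "(real \<Rightarrow> real) \<Rightarrow> real \<Rightarrow> real" where
  "elasticity g y = y * deriv g y / g y"

text \<open>
  Functions on the half-line \<open>[0,\<infinity>)\<close> are represented by total functions whose
  values at negative arguments are irrelevant. All derivatives at \<open>0\<close> are therefore one-sided;
  \<^const>\<open>deriv\<close> is only used at positive arguments.
\<close>

definition smooth_halfline :: "(real \<Rightarrow> real) \<Rightarrow> bool" where
  "smooth_halfline f \<longleftrightarrow>
     (\<exists>D :: nat \<Rightarrow> real \<Rightarrow> real. (\<forall>y\<ge>0. D 0 y = f y) \<and>
        (\<forall>n. \<forall>y\<ge>0. (D n has_real_derivative D (Suc n) y) (at y within {0..})))"

definition analytic_at_origin :: "(real \<Rightarrow> real) \<Rightarrow> bool" where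
  "analytic_at_origin f \<longleftrightarrow>
     (\<exists>(a :: nat \<Rightarrow> real) r. 0 < r \<and> (\<forall>y. 0 \<le> y \<and> y < r \<longrightarrow> (\<lambda>n. a n * y ^ n) sums f y))"

definition strictly_convex_on :: "real set \<Rightarrow> (real \<Rightarrow> real) \<Rightarrow> bool" where
  "strictly_convex_on S f \<longleftrightarrow> convex S \<and>
     (\<forall>x\<in>S. \<forall>y\<in>S. \<forall>t. x \<noteq> y \<and> 0 < t \<and> t < 1 \<longrightarrow>
        f ((1 - t) * x + t * y) < (1 - t) * f x + t * f y)"

definition elastic :: "real \<Rightarrow> real \<Rightarrow> (real \<Rightarrow> real) \<Rightarrow> bool" where
  "elastic \<tau> \<sigma> f \<longleftrightarrow>
     (\<forall>y\<ge>0. 0 \<le> f y) \<and>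
     strict_mono_on {0..} f \<and>
     smooth_halfline f \<and>
     strictly_convex_on {0..} f \<and>
     analytic_at_origin f \<and>
     f 0 = 0 \<and> (f has_real_derivative 0) (at 0 within {0..}) \<and>
     mono_on {0<..} (elasticity (deriv f)) \<and>
     (\<forall>y>0. \<tau> - 1 \<le> elasticity (deriv f) y \<and> elasticity (deriv f) y \<le> \<sigma> - 1)"

definition strongly_elastic :: "real \<Rightarrow> real \<Rightarrow> (real \<Rightarrow> real) \<Rightarrow> bool" where
  "strongly_elastic \<tau> \<sigma> f \<longleftrightarrow> elastic \<tau> \<sigma> f \<and>
     (\<forall>y>0. \<tau> - 2 \<le> elasticity (deriv (deriv f)) y \<and> elasticity (deriv (deriv f)) y \<le> \<sigma> - 2)"

definition tight_elasticity :: "real \<Rightarrow> real \<Rightarrow> (real \<Rightarrow> real) \<Rightarrow> bool" where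
  "tight_elasticity \<tau> \<sigma> f \<longleftrightarrow>
     (INF y\<in>{0<..}. elasticity (deriv f) y) = \<tau> - 1 \<and>
     (SUP y\<in>{0<..}. elasticity (deriv f) y) = \<sigma> - 1"

definition alpha_star :: "real \<Rightarrow> real" where
  "alpha_star \<sigma> = \<sigma> powr (\<sigma> / (\<sigma> - 1))"

text \<open>For \<open>\<sigma> = \<tau>\<close> the two positive roots coincide.\<close>

definition chi_minus :: "real \<Rightarrow> real \<Rightarrow> real" where
  "chi_minus \<tau> \<sigma> =
     (LEAST z. 0 < z \<and> z powr \<tau> - alpha_star \<sigma> / (\<tau> - 1) * (z powr (\<tau> - 1) - 1) = 0)"

definition reserve_field :: "(real \<Rightarrow> real) \<Rightarrow> real \<Rightarrow> real \<Rightarrow> real" where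
  "reserve_field f p y = (deriv f p - deriv f y) / (p * deriv (deriv f) p)"

text \<open>
  The domain \<open>J\<close> is \<open>{0..Y}\<close> or \<open>{0..}\<close>. The differential equation is only imposed at positive
  arguments, so continuity at \<open>0\<close> is required explicitly; otherwise the initial condition
  \<open>\<phi> 0 = 0\<close> would say nothing about \<open>\<phi>\<close> elsewhere.
\<close>

definition competitive_on :: "(real \<Rightarrow> real) \<Rightarrow> real \<Rightarrow> real set \<Rightarrow> (real \<Rightarrow> real) \<Rightarrow> bool" where
  "competitive_on f \<alpha> J \<phi> \<longleftrightarrow>
     \<phi> 0 = 0 \<and> continuous_on J \<phi> \<and>
     (\<forall>y\<in>J. 0 < y \<longrightarrow>
        (\<exists>d. (\<phi> has_real_derivative d) (at y within J) \<and>
             d = \<alpha> * reserve_field f (\<phi> y) y \<and> 0 \<le> d) \<and>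
        y \<le> \<phi> y)"

definition phi_lb :: "(real \<Rightarrow> real) \<Rightarrow> real \<Rightarrow> real \<Rightarrow> real \<Rightarrow> real" where
  "phi_lb f \<tau> \<sigma> y =
     (INF \<phi>\<in>{\<phi>. competitive_on f (alpha_star \<sigma>) {0..} \<phi> \<and>
                 (\<phi> has_real_derivative chi_minus \<tau> \<sigma>) (at 0 within {0..})}. \<phi> y)"

text \<open>
  The right-hand side of the equation is regular only for positive \<open>y\<close> and \<open>\<phi> y\<close>. If \<open>0 \<in> J\<close>,
  then \<open>\<phi> 0\<close> is the limit of the solution at \<open>0\<close>, which is not prescribed.
\<close>

definition solution_on :: "(real \<Rightarrow> real) \<Rightarrow> real \<Rightarrow> real set \<Rightarrow> (real \<Rightarrow> real) \<Rightarrow> bool" where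
  "solution_on f \<alpha> J \<phi> \<longleftrightarrow>
     is_interval J \<and> J \<subseteq> {0..} \<and> continuous_on J \<phi> \<and>
     (\<forall>y\<in>J. 0 < y \<longrightarrow>
        0 < \<phi> y \<and> (\<phi> has_real_derivative \<alpha> * reserve_field f (\<phi> y) y) (at y within J))"

definition solution_value ::
  "(real \<Rightarrow> real) \<Rightarrow> real \<Rightarrow> real \<Rightarrow> real \<Rightarrow> real \<Rightarrow> real \<Rightarrow> bool" where
  "solution_value f \<alpha> \<xi> \<eta> y v \<longleftrightarrow>
     (\<exists>J \<phi>. solution_on f \<alpha> J \<phi> \<and> \<xi> \<in> J \<and> y \<in> J \<and> \<phi> \<xi> = \<eta> \<and> \<phi> y = v)"

text \<open>
  The maximal solution through \<open>(\<xi>, \<eta>)\<close>. Outside its interval of existence it is set to \<open>0\<close>,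
  which violates \<open>y \<le> \<phi> y\<close> for positive \<open>y\<close>, so it cannot be competitive on an interval to which
  the solution does not extend.
\<close>

definition maximal_solution ::
  "(real \<Rightarrow> real) \<Rightarrow> real \<Rightarrow> real \<Rightarrow> real \<Rightarrow> real \<Rightarrow> real" where
  "maximal_solution f \<alpha> \<xi> \<eta> y =
     (if \<exists>v. solution_value f \<alpha> \<xi> \<eta> y v then THE v. solution_value f \<alpha> \<xi> \<eta> y v else 0)"

definition phi_lb_from :: "(real \<Rightarrow> real) \<Rightarrow> real \<Rightarrow> real \<Rightarrow> real \<Rightarrow> real \<Rightarrow> real" where
  "phi_lb_from f \<tau> \<sigma> \<xi> = maximal_solution f (alpha_star \<sigma>) \<xi> (chi_minus \<tau> \<sigma> * \<xi>)"

end

theory Submission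
  imports Defs
begin

text \<open>
  For \<open>z = \<phi> y / y\<close> and \<open>t = ln y\<close> the equation reads \<open>z' = \<alpha> F (z y) y - z\<close>. By strong elasticity
  \<open>F (z y) y\<close> lies between the values \<open>(1 - z powr (1 - s)) / (s - 1)\<close> of power costs, for
  \<open>s = \<sigma>\<close> and \<open>s = \<tau>\<close>, when \<open>z \<ge> 1\<close>. Hence \<open>z\<close> crosses the smaller root \<open>\<chi>\<close> for \<open>\<tau>\<close> only
  downwards and the double root \<open>\<beta> = \<sigma> powr (1 / (\<sigma> - 1))\<close> for \<open>\<sigma>\<close> only upwards, so the solution
  through \<open>(\<xi>, \<chi> \<xi>)\<close> stays in \<open>[\<chi>, \<beta>]\<close> before \<open>\<xi>\<close>; after \<open>\<xi>\<close> it satisfies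
  \<open>\<phi> \<ge> \<chi> \<xi>\<close>, and therefore \<open>\<phi> y \<ge> y\<close>, up to \<open>y = \<chi> \<xi>\<close>.
  Solutions that fall below \<open>z = \<chi>\<close> eventually violate \<open>z \<ge> 1\<close>, so every global feasible solution
  dominates all of these. By compactness a subsequence converges as \<open>\<xi> \<rightarrow> \<infinity>\<close> to a global
  solution with values of \<open>z\<close> in \<open>[\<chi>, \<beta>]\<close>; such a solution has slope \<open>\<chi>\<close> at the origin,
  hence is the smallest feasible one.
\<close>

subsection \<open>Scalar differential equations\<close>

text \<open>The differential inequality is asked only where \<open>w\<close> is positive, the form
  that barrier arguments supply. After the last time \<open>Sup S\<close> at which \<open>w\<close>
  is not positive, \<open>w t * exp (- L * t)\<close> cannot increase, so \<open>w\<close> cannot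
  become positive at all.\<close>

lemma nonpos_forward:
  fixes w :: "real \<Rightarrow> real"
  assumes "a \<le> b" and cont: "continuous_on {a..b} w" and "w a \<le> 0"
    and der: "\<And>t. a < t \<Longrightarrow> t < b \<Longrightarrow> 0 < w t \<Longrightarrow>
      \<exists>d. (w has_real_derivative d) (at t) \<and> d \<le> L * w t"
  shows "w b \<le> 0"
proof (rule ccontr)
  assume "\<not> w b \<le> 0"
  then have pos: "0 < w b" by simp
  define S where "S = {t \<in> {a..b}. w t \<le> 0}"
  have "closed S"
    unfolding S_def by (intro continuous_on_closed_Collect_le cont continuous_intros)
  moreover have S: "a \<in> S" "bdd_above S"
    using assms by (auto simp: S_def intro!: bdd_aboveI[where M = b])
  ultimately have "Sup S \<in> S" by (intro closed_contains_Sup) auto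
  then have s: "a \<le> Sup S" "Sup S \<le> b" "w (Sup S) \<le> 0" by (auto simp: S_def)
  then have "Sup S < b" using pos by (cases "Sup S = b") auto
  have after: "0 < w t" if "Sup S < t" "t \<le> b" for t
    using cSup_upper[of t S] S that s by (force simp: S_def)
  have "w b * exp (- L * b) \<le> w (Sup S) * exp (- L * Sup S)"
  proof (rule DERIV_nonpos_imp_decreasing_open[where f = "\<lambda>t. w t * exp (- L * t)"])
    show "Sup S \<le> b" by (fact s)
    show "continuous_on {Sup S..b} (\<lambda>t. w t * exp (- L * t))"
      using s by (intro continuous_intros continuous_on_subset[OF cont]) auto
    fix t assume t: "Sup S < t" "t < b"
    then obtain d where d: "(w has_real_derivative d) (at t)" "d \<le> L * w t"
      using der[of t] after[of t] s by force
    have "((\<lambda>t. w t * exp (- L * t)) has_real_derivative (d - L * w t) * exp (- L * t)) (at t)"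
      by (auto intro!: derivative_eq_intros d simp: algebra_simps)
    then show "\<exists>y. ((\<lambda>t. w t * exp (- L * t)) has_real_derivative y) (at t) \<and> y \<le> 0"
      using d(2) by (intro exI conjI) (auto simp: mult_nonpos_nonneg)
  qed
  also have "\<dots> \<le> 0" using s by (simp add: mult_nonpos_nonneg)
  finally show False using pos by (simp add: mult_le_0_iff)
qed

text \<open>Time reversal of the forward version: the growth estimate becomes a lower bound on the
  derivative.\<close>

lemma nonpos_backward:
  fixes w :: "real \<Rightarrow> real"
  assumes "a \<le> b" and cont: "continuous_on {a..b} w" and "w b \<le> 0"
    and der: "\<And>t. a < t \<Longrightarrow> t < b \<Longrightarrow> 0 < w t \<Longrightarrow>
      \<exists>d. (w has_real_derivative d) (at t) \<and> - L * w t \<le> d"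
  shows "w a \<le> 0"
proof -
  have "w (- (- a)) \<le> 0"
  proof (rule nonpos_forward[where w = "\<lambda>t. w (- t)" and a = "- b" and L = L])
    show "continuous_on {- b..- a} (\<lambda>t. w (- t))"
      by (intro continuous_on_compose2[OF cont] continuous_intros) auto
    fix t assume t: "- b < t" "t < - a" "0 < w (- t)"
    then obtain d where d: "(w has_real_derivative d) (at (- t))" "- L * w (- t) \<le> d"
      using der[of "- t"] by force
    have "((\<lambda>t. w (- t)) has_real_derivative d * - 1) (at t)"
      by (rule DERIV_chain2[where f = w and g = uminus, OF d(1)]) (auto intro!: derivative_eq_intros)
    then show "\<exists>d. ((\<lambda>t. w (- t)) has_real_derivative d) (at t) \<and> d \<le> L * w (- t)"
      using d(2) by (intro exI conjI) auto
  qed (use assms in auto)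
  then show ?thesis by simp
qed

text \<open>Integrates the bound on \<open>g\<close> outwards from \<open>t0\<close>, once in each
  direction. The exponential weight reproduces itself up to the factor \<open>1 / K\<close>, which
  is what makes the weighted integral operator contract.\<close>

lemma exponential_growth_bound:
  fixes G :: "real \<Rightarrow> real"
  assumes der: "\<And>t. (G has_real_derivative g t) (at t)"
    and bound: "\<And>t. \<bar>g t\<bar> \<le> D * exp (K * \<bar>t - t0\<bar>)" and "0 < K"
  shows "\<bar>G t - G t0\<bar> \<le> D / K * exp (K * \<bar>t - t0\<bar>)"
proof -
  have D: "0 \<le> D" using bound[of t0] by simp
  have cont: "continuous_on S G" for S
    using der by (meson DERIV_continuous_on has_field_derivative_at_within)
  note vec = der[unfolded has_real_derivative_iff_has_vector_derivative]
  consider "t0 < t" | "t < t0" | "t = t0" by linarith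
  then show ?thesis
  proof cases
    case 1
    have "norm (G t - G t0) \<le> D / K * exp (K * (t - t0)) - D / K * exp (K * (t0 - t0))"
    proof (rule differentiable_bound_general[OF 1, where f' = g])
      show "((\<lambda>t. D / K * exp (K * (t - t0))) has_vector_derivative D * exp (K * (s - t0))) (at s)"
        for s
        unfolding has_real_derivative_iff_has_vector_derivative[symmetric]
        using \<open>0 < K\<close> by (auto intro!: derivative_eq_intros)
      show "norm (g s) \<le> D * exp (K * (s - t0))" if "t0 < s" for s
        using bound[of s] that by simp
    qed (use cont vec \<open>0 < K\<close> in \<open>auto intro!: continuous_intros\<close>)
    also have "\<dots> \<le> D / K * exp (K * \<bar>t - t0\<bar>)" using D \<open>0 < K\<close> 1 by simp
    finally show ?thesis by simp
  next
    case 2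
    have "norm (G t0 - G t) \<le> - D / K * exp (K * (t0 - t0)) - - D / K * exp (K * (t0 - t))"
    proof (rule differentiable_bound_general[OF 2, where f' = g])
      show "((\<lambda>t. - D / K * exp (K * (t0 - t))) has_vector_derivative D * exp (K * (t0 - s))) (at s)"
        for s
        unfolding has_real_derivative_iff_has_vector_derivative[symmetric]
        using \<open>0 < K\<close> by (auto intro!: derivative_eq_intros)
      show "norm (g s) \<le> D * exp (K * (t0 - s))" if "s < t0" for s
        using bound[of s] that by simp
    qed (use cont vec \<open>0 < K\<close> in \<open>auto intro!: continuous_intros\<close>)
    also have "\<dots> \<le> D / K * exp (K * \<bar>t - t0\<bar>)" using D \<open>0 < K\<close> 2 by simp
    finally show ?thesis by simp
  next
    case 3
    then show ?thesis using D \<open>0 < K\<close> by simp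
  qed
qed

lemma antiderivative_real:
  fixes g :: "real \<Rightarrow> real"
  assumes "continuous_on UNIV g"
  obtains G where "G t0 = c" "\<And>t. (G has_real_derivative g t) (at t)"
proof -
  have "isCont g t" for t using assms continuous_on_eq_continuous_at open_UNIV by blast
  then obtain F where F: "\<And>t. (F has_real_derivative g t) (at t)"
    using einterval_antiderivative[of "-\<infinity>" "\<infinity>" g]
    by (auto simp: has_real_derivative_iff_has_vector_derivative)
  show ?thesis
  proof (rule that[of "\<lambda>t. F t - F t0 + c"])
    show "((\<lambda>t. F t - F t0 + c) has_real_derivative g t) (at t)" for t
      by (auto intro!: derivative_eq_intros F)
  qed simp
qed

text \<open>
  Weighting the sup norm by \<open>exp (- 2 * L * \<bar>t - t0\<bar>)\<close> turns the integral operator into a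
  contraction on the whole line at once.
\<close>

theorem bounded_Lipschitz_solution_exists:
  fixes h :: "real \<Rightarrow> real \<Rightarrow> real"
  assumes cont: "continuous_on UNIV (\<lambda>(t, x). h t x)"
    and bound: "\<And>t x. \<bar>h t x\<bar> \<le> M"
    and lip: "\<And>t x y. \<bar>h t x - h t y\<bar> \<le> L * \<bar>x - y\<bar>" and "0 < L"
  obtains x where "x t0 = x0" "\<And>t. (x has_real_derivative h t (x t)) (at t)"
proof -
  define E where "E t = exp (2 * L * \<bar>t - t0\<bar>)" for t
  have E: "1 \<le> E t" "0 < E t" for t using \<open>0 < L\<close> by (auto simp: E_def)
  have E_cont: "continuous_on S E" for S unfolding E_def by (intro continuous_intros)
  have M: "0 \<le> M" using bound[of 0 0] by linarith
  \<comment> \<open>A candidate solution is stored as \<open>E t * apply_bcontfun v t\<close>, so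
    that \<open>v\<close> lives in the complete space of bounded continuous functions;
    \<open>P v\<close> is the integral of the field along it, started at \<open>x0\<close>.\<close>
  define P where "P v = (SOME G. G t0 = x0 \<and>
      (\<forall>t. (G has_real_derivative h t (E t * apply_bcontfun v t)) (at t)))" for v
  have P: "P v t0 = x0" "(P v has_real_derivative h t (E t * apply_bcontfun v t)) (at t)" for v t
  proof -
    have "continuous_on UNIV (\<lambda>t. (\<lambda>(t, x). h t x) (t, E t * apply_bcontfun v t))"
      by (intro continuous_on_compose2[OF cont] continuous_intros E_cont) auto
    then have "continuous_on UNIV (\<lambda>t. h t (E t * apply_bcontfun v t))" by simp
    then have "\<exists>G. G t0 = x0 \<and>
        (\<forall>t. (G has_real_derivative h t (E t * apply_bcontfun v t)) (at t))"
      by (rule antiderivative_real) blast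
    from someI_ex[OF this] show "P v t0 = x0"
      "(P v has_real_derivative h t (E t * apply_bcontfun v t)) (at t)"
      by (auto simp: P_def)
  qed
  define T where "T v = Bcontfun (\<lambda>t. P v t / E t)" for v
  have T: "apply_bcontfun (T v) t = P v t / E t" for v t
  proof -
    have "\<bar>P v s / E s\<bar> \<le> \<bar>x0\<bar> + M / (2 * L)" for s
    proof -
      have "M * 1 \<le> M * exp (2 * L * \<bar>s - t0\<bar>)" for s
        using M \<open>0 < L\<close> by (intro mult_left_mono) auto
      then have "\<bar>h s (E s * apply_bcontfun v s)\<bar> \<le> M * exp (2 * L * \<bar>s - t0\<bar>)" for s
        using order_trans[OF bound] by simp
      then have "\<bar>P v s - P v t0\<bar> \<le> M / (2 * L) * exp (2 * L * \<bar>s - t0\<bar>)"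
        using \<open>0 < L\<close> by (intro exponential_growth_bound[OF P(2)]) auto
      then have "\<bar>P v s\<bar> \<le> \<bar>x0\<bar> * 1 + M / (2 * L) * E s"
        unfolding P(1) E_def by linarith
      also have "\<dots> \<le> \<bar>x0\<bar> * E s + M / (2 * L) * E s"
        using E(1)[of s] by (intro add_right_mono mult_left_mono) auto
      finally show ?thesis using E(2)[of s] by (simp add: pos_divide_le_eq distrib_right)
    qed
    moreover have "continuous_on UNIV (\<lambda>t. P v t / E t)"
    proof (rule continuous_on_divide[OF _ E_cont])
      show "continuous_on UNIV (P v)"
        by (rule DERIV_continuous_on) (rule P(2)[THEN has_field_derivative_at_within])
      show "\<forall>t\<in>UNIV. E t \<noteq> 0" using E(2) by (metis less_irrefl)
    qed
    ultimately have "(\<lambda>t. P v t / E t) \<in> bcontfun"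
      by (auto simp: bcontfun_def bounded_iff)
    then show ?thesis by (simp add: T_def Bcontfun_inverse)
  qed
  \<comment> \<open>The factor \<open>1 / 2\<close> is \<open>L / (2 * L)\<close>: the Lipschitz
    constant over the rate of the weight.\<close>
  have "dist (T v) (T u) \<le> 1 / 2 * dist v u" for v u
  proof (rule dist_bound)
    fix t
    have "\<bar>h s (E s * apply_bcontfun v s) - h s (E s * apply_bcontfun u s)\<bar>
        \<le> L * dist v u * exp (2 * L * \<bar>s - t0\<bar>)" for s
    proof -
      have "\<bar>h s (E s * apply_bcontfun v s) - h s (E s * apply_bcontfun u s)\<bar>
          \<le> L * \<bar>E s * apply_bcontfun v s - E s * apply_bcontfun u s\<bar>" by (rule lip)
      also have "\<dots> = L * (E s * dist (apply_bcontfun v s) (apply_bcontfun u s))"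
        using E(2)[of s] by (simp add: dist_real_def abs_mult flip: right_diff_distrib)
      also have "\<dots> \<le> L * (E s * dist v u)"
        using E(2)[of s] \<open>0 < L\<close> by (intro mult_left_mono dist_bounded) auto
      finally show ?thesis by (simp add: E_def mult_ac)
    qed
    then have "\<bar>(P v t - P u t) - (P v t0 - P u t0)\<bar>
        \<le> L * dist v u / (2 * L) * exp (2 * L * \<bar>t - t0\<bar>)"
      using \<open>0 < L\<close>
      by (intro exponential_growth_bound[where G = "\<lambda>t. P v t - P u t"]) (auto intro!: derivative_eq_intros P(2))
    then have "\<bar>P v t - P u t\<bar> \<le> 1 / 2 * dist v u * E t"
      using \<open>0 < L\<close> by (simp add: P(1) E_def)
    then show "dist (apply_bcontfun (T v) t) (apply_bcontfun (T u) t) \<le> 1 / 2 * dist v u"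
      unfolding T dist_real_def diff_divide_distrib[symmetric]
      using E(2)[of t] by (simp add: pos_divide_le_eq)
  qed
  then have "\<exists>!v. T v = v"
    by (intro banach_fix_type[where c = "1 / 2"]) auto
  then obtain v where v: "T v = v" by blast
  have "E t * apply_bcontfun v t = P v t" for t
    using T[of v t] E(2)[of t] by (simp add: v)
  then show ?thesis using P[of v] by (intro that[of "P v"]) auto
qed

text \<open>The square \<open>w\<close> of the difference is differentiable even where the solutions
  meet, and its derivative is at most \<open>2 * L * w\<close> in absolute value. Hence
  \<open>w t * exp (- 2 * L * t)\<close> is non-increasing and \<open>w t * exp (2 * L * t)\<close>
  is non-decreasing; square roots give the claim.\<close>

lemma solution_dependence:
  fixes h :: "real \<Rightarrow> real \<Rightarrow> real"
  assumes x: "\<And>t. (x has_real_derivative h t (x t)) (at t)"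
    and y: "\<And>t. (y has_real_derivative h t (y t)) (at t)"
    and lip: "\<And>t u v. \<bar>h t u - h t v\<bar> \<le> L * \<bar>u - v\<bar>" and "0 \<le> L"
  shows "\<bar>x t - y t\<bar> \<le> exp (L * \<bar>t - s\<bar>) * \<bar>x s - y s\<bar>"
proof -
  define w where "w t = (x t - y t)\<^sup>2" for t
  have "(w has_real_derivative 2 * (x t - y t) * (h t (x t) - h t (y t))) (at t)" for t
    unfolding w_def by (auto intro!: derivative_eq_intros x y)
  then have wE: "((\<lambda>t. w t * exp (c * t)) has_real_derivative
      (2 * (x t - y t) * (h t (x t) - h t (y t)) + c * w t) * exp (c * t)) (at t)" for c t
    by (auto intro!: derivative_eq_intros simp: algebra_simps)
  have est: "\<bar>2 * (x t - y t) * (h t (x t) - h t (y t))\<bar> \<le> 2 * L * w t" for t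
  proof -
    have "\<bar>x t - y t\<bar> * \<bar>h t (x t) - h t (y t)\<bar> \<le> \<bar>x t - y t\<bar> * (L * \<bar>x t - y t\<bar>)"
      by (intro mult_left_mono lip) auto
    moreover have "\<bar>x t - y t\<bar> * (L * \<bar>x t - y t\<bar>) = L * w t"
      unfolding w_def power2_abs[symmetric, of "x t - y t"] by (simp only: power2_eq_square mult_ac)
    ultimately show ?thesis unfolding abs_mult abs_numeral by linarith
  qed
  have "w t \<le> exp (2 * L * \<bar>t - s\<bar>) * w s"
  proof (cases "s \<le> t")
    case True
    have "w t * exp (- (2 * L) * t) \<le> w s * exp (- (2 * L) * s)"
    proof (rule DERIV_nonpos_imp_nonincreasing[OF True], intro exI conjI, rule wE)
      show "(2 * (x r - y r) * (h r (x r) - h r (y r)) + - (2 * L) * w r) * exp (- (2 * L) * r) \<le> 0"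
        for r
        using est[of r] by (intro mult_nonpos_nonneg) (linarith, simp)
    qed
    then have "w t * exp (- (2 * L) * t) * exp (2 * L * t)
        \<le> w s * exp (- (2 * L) * s) * exp (2 * L * t)"
      by (rule mult_right_mono) simp
    moreover have "exp (- (2 * L) * t) * exp (2 * L * t) = 1"
      "exp (- (2 * L) * s) * exp (2 * L * t) = exp (2 * L * \<bar>t - s\<bar>)"
      using True unfolding exp_add[symmetric] by (simp_all add: algebra_simps)
    ultimately show ?thesis by (simp only: mult.assoc mult_1_right mult.commute[of _ "w s"])
  next
    case False
    then have "t \<le> s" by simp
    have "w t * exp (2 * L * t) \<le> w s * exp (2 * L * s)"
    proof (rule DERIV_nonneg_imp_nondecreasing[OF \<open>t \<le> s\<close>], intro exI conjI, rule wE)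
      show "0 \<le> (2 * (x r - y r) * (h r (x r) - h r (y r)) + 2 * L * w r) * exp (2 * L * r)"
        for r
        using est[of r] by (intro mult_nonneg_nonneg) (linarith, simp)
    qed
    then have "w t * exp (2 * L * t) * exp (- (2 * L) * t)
        \<le> w s * exp (2 * L * s) * exp (- (2 * L) * t)"
      by (rule mult_right_mono) simp
    moreover have "exp (2 * L * t) * exp (- (2 * L) * t) = 1"
      "exp (2 * L * s) * exp (- (2 * L) * t) = exp (2 * L * \<bar>t - s\<bar>)"
      using False unfolding exp_add[symmetric] by (simp_all add: algebra_simps)
    ultimately show ?thesis by (simp only: mult.assoc mult_1_right mult.commute[of _ "w s"])
  qed
  also have "exp (2 * L * \<bar>t - s\<bar>) * w s = (exp (L * \<bar>t - s\<bar>) * \<bar>x s - y s\<bar>)\<^sup>2"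
    by (simp add: w_def power_mult_distrib mult_ac flip: exp_double)
  finally have "\<bar>x t - y t\<bar>\<^sup>2 \<le> (exp (L * \<bar>t - s\<bar>) * \<bar>x s - y s\<bar>)\<^sup>2"
    by (simp add: w_def)
  then show ?thesis by (rule power2_le_imp_le) auto
qed

subsection \<open>Power costs\<close>

text \<open>The growth condition says that \<open>u s * s powr (- e)\<close> has a non-negative
  derivative. No sign of \<open>u\<close> is assumed, so upper bounds follow by applying this to the
  negated function.\<close>

lemma powr_growth:
  fixes u u' :: "real \<Rightarrow> real"
  assumes "0 < a" "a \<le> b"
    and der: "\<And>s. a \<le> s \<Longrightarrow> s \<le> b \<Longrightarrow> (u has_real_derivative u' s) (at s)"
    and growth: "\<And>s. a \<le> s \<Longrightarrow> s \<le> b \<Longrightarrow> e * u s \<le> s * u' s"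
  shows "u a * (b / a) powr e \<le> u b"
proof -
  have "u a * a powr (- e) \<le> u b * b powr (- e)"
  proof (rule DERIV_nonneg_imp_nondecreasing[OF \<open>a \<le> b\<close>], intro exI conjI)
    fix s assume s: "a \<le> s" "s \<le> b"
    then have "0 < s" using \<open>0 < a\<close> by simp
    then show "((\<lambda>s. u s * s powr (- e)) has_real_derivative
        (s * u' s - e * u s) * s powr (- e - 1)) (at s)"
      by (auto intro!: derivative_eq_intros der s simp: powr_diff field_simps)
    show "0 \<le> (s * u' s - e * u s) * s powr (- e - 1)" using growth[OF s] by simp
  qed
  then have "u a * a powr (- e) * b powr e \<le> u b * b powr (- e) * b powr e"
    by (rule mult_right_mono) simp
  then show ?thesis using assms(1,2) by (simp add: powr_divide powr_minus field_simps)
qed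

text \<open>For the cost \<open>y powr s\<close> the quotient \<open>F\<close> at
  \<open>(z * y, y)\<close> equals this expression, independently of \<open>y\<close>.\<close>

definition power_field :: "real \<Rightarrow> real \<Rightarrow> real" where
  "power_field s z = (1 - z powr (1 - s)) / (s - 1)"

lemma power_field_1 [simp]: "power_field s 1 = 0"
  by (simp add: power_field_def)

lemma power_field_deriv:
  assumes "s \<noteq> 1" "0 < z"
  shows "(power_field s has_real_derivative z powr (- s)) (at z)"
proof -
  have "((\<lambda>z. (1 - z powr (1 - s)) / (s - 1)) has_real_derivative
      (0 - (1 - s) * z powr (1 - s - 1)) / (s - 1)) (at z)"
    by (intro DERIV_cdivide DERIV_diff DERIV_const has_real_derivative_powr assms)
  moreover have "(0 - (1 - s) * z powr (1 - s - 1)) / (s - 1) = z powr (- s)"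
    using assms by (simp add: field_simps)
  ultimately show ?thesis by (simp add: power_field_def[abs_def])
qed

lemma power_field_continuous:
  assumes "s \<noteq> 1" "A \<subseteq> {0<..}"
  shows "continuous_on A (power_field s)"
  by (rule DERIV_continuous_on)
    (use assms in \<open>auto intro!: has_field_derivative_at_within[OF power_field_deriv]\<close>)

lemma power_field_bounds:
  assumes "1 < s" "1 \<le> z"
  shows "0 \<le> power_field s z" "power_field s z \<le> 1 / (s - 1)"
proof -
  have "z powr (1 - s) \<le> 1" using assms powr_mono[of "1 - s" 0 z] by simp
  then show "0 \<le> power_field s z" using assms by (simp add: power_field_def)
  show "power_field s z \<le> 1 / (s - 1)"
    unfolding power_field_def using assms by (intro divide_right_mono) auto
qed

text \<open>Both sides vanish at 1, and their derivatives \<open>x powr (- r)\<close> and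
  \<open>x powr (- s)\<close> are strictly ordered for \<open>x > 1\<close>.\<close>

lemma power_field_strict_antimono_exponent:
  assumes "1 < s" "s < r" "1 < z"
  shows "power_field r z < power_field s z"
proof -
  have "power_field s 1 - power_field r 1 < power_field s z - power_field r z"
  proof (rule DERIV_pos_imp_increasing_open[OF \<open>1 < z\<close>])
    show "\<exists>y. ((\<lambda>z. power_field s z - power_field r z) has_real_derivative y) (at x) \<and> 0 < y"
      if "1 < x" for x
      using assms that
      by (intro exI[of _ "x powr (- s) - x powr (- r)"] conjI)
        (auto intro!: derivative_eq_intros power_field_deriv)
    show "continuous_on {1..z} (\<lambda>z. power_field s z - power_field r z)"
      using assms by (intro continuous_intros power_field_continuous) auto
  qed
  then show ?thesis by simp
qed

lemma power_field_diff_le: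
  assumes "1 < s" "1 \<le> x" "x \<le> z"
  shows "power_field s z - power_field s x \<le> z - x"
proof -
  have "x - power_field s x \<le> z - power_field s z"
  proof (rule DERIV_nonneg_imp_nondecreasing[OF \<open>x \<le> z\<close>], intro exI conjI)
    fix y assume "x \<le> y" "y \<le> z"
    then have y: "1 \<le> y" using assms(2) by simp
    show "((\<lambda>x. x - power_field s x) has_real_derivative 1 - y powr (- s)) (at y)"
      using y assms(1) by (intro DERIV_diff DERIV_ident power_field_deriv) auto
    show "0 \<le> 1 - y powr (- s)" using y assms(1) powr_mono[of "- s" 0 y] by simp
  qed
  then show ?thesis by simp
qed

lemma power_field_concave:
  assumes "1 < s"
  shows "concave_on {1..b} (power_field s)"
proof (rule f''_le0_imp_concave)
  fix x :: real assume "x \<in> {1..b}"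
  then have "0 < x" by simp
  then show "(power_field s has_real_derivative x powr (- s)) (at x)"
    using assms by (intro power_field_deriv) auto
  show "((\<lambda>x. x powr (- s)) has_real_derivative - s * x powr (- s - 1)) (at x)"
    using \<open>0 < x\<close> by (auto intro!: derivative_eq_intros)
  show "- s * x powr (- s - 1) \<le> 0" using assms by simp
qed simp

text \<open>The elasticity bound on \<open>u'\<close> compares \<open>u' s\<close> with the power of
  \<open>s\<close> of exponent \<open>e - 2\<close> that agrees with it at \<open>p\<close>;
  integrating from \<open>y\<close> to \<open>p\<close> yields \<open>power_field e\<close>. As
  \<open>u\<close> may have any sign, the negated function gives the opposite estimate.\<close>

lemma gap_ge_power_field:
  fixes u u' u'' :: "real \<Rightarrow> real"
  assumes "0 < y" "y \<le> p" "e \<noteq> 1"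
    and u: "\<And>s. y \<le> s \<Longrightarrow> s \<le> p \<Longrightarrow> (u has_real_derivative u' s) (at s)"
    and u': "\<And>s. y \<le> s \<Longrightarrow> s \<le> p \<Longrightarrow> (u' has_real_derivative u'' s) (at s)"
    and el: "\<And>s. y \<le> s \<Longrightarrow> s \<le> p \<Longrightarrow> s * u'' s \<le> (e - 2) * u' s"
  shows "p * u' p * power_field e (p / y) \<le> u p - u y"
proof -
  have u'_ge: "u' p * (p / s) powr (2 - e) \<le> u' s" if s: "y \<le> s" "s \<le> p" for s
  proof -
    have "0 < s" using s \<open>0 < y\<close> by simp
    have "- u' s * (p / s) powr (e - 2) \<le> - u' p"
      by (rule powr_growth[where u = "\<lambda>s. - u' s" and u' = "\<lambda>s. - u'' s"])
        (use s \<open>0 < y\<close> el in \<open>auto intro!: derivative_intros u'\<close>)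
    then have "u' p * (p / s) powr (2 - e) \<le> u' s * (p / s) powr (e - 2) * (p / s) powr (2 - e)"
      by (intro mult_right_mono) auto
    then show ?thesis using s \<open>0 < s\<close> by (simp add: mult.assoc flip: powr_add)
  qed
  \<comment> \<open>Chosen so that the derivative of \<open>C * s powr (e - 1)\<close> is
    \<open>u' p * (p / s) powr (2 - e)\<close>, the lower bound just obtained.\<close>
  define C where "C = p * u' p / (e - 1) * p powr (1 - e)"
  define k where "k s = u s - C * s powr (e - 1)" for s
  have "k y \<le> k p"
  proof (rule DERIV_nonneg_imp_nondecreasing[OF \<open>y \<le> p\<close>], intro exI conjI)
    fix s assume s: "y \<le> s" "s \<le> p"
    then have pos: "0 < s" "0 < p" using \<open>0 < y\<close> by auto
    show "(k has_real_derivative u' s - u' p * (p / s) powr (2 - e)) (at s)"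
    proof -
      have "(k has_real_derivative u' s - C * ((e - 1) * s powr (e - 1 - 1))) (at s)"
        unfolding k_def
        by (intro DERIV_diff DERIV_cmult has_real_derivative_powr u s pos)
      moreover have "C * ((e - 1) * s powr (e - 1 - 1)) = u' p * (p / s) powr (2 - e)"
        unfolding C_def using pos \<open>e \<noteq> 1\<close>
        by (simp add: powr_divide powr_diff power2_eq_square field_simps)
      ultimately show ?thesis by simp
    qed
    show "0 \<le> u' s - u' p * (p / s) powr (2 - e)" using u'_ge[OF s] by simp
  qed
  moreover have "k p - k y = u p - u y - p * u' p * power_field e (p / y)"
  proof -
    have "C * p powr (e - 1) = p * u' p / (e - 1)"
      using assms(1,2) by (simp add: C_def mult.assoc flip: powr_add)
    moreover have "C * y powr (e - 1) = p * u' p / (e - 1) * (p / y) powr (1 - e)"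
      using assms(1,2) powr_minus_divide[of y "1 - e"] by (simp add: C_def powr_divide)
    ultimately show ?thesis
      by (simp add: k_def power_field_def algebra_simps diff_divide_distrib)
  qed
  ultimately show ?thesis by simp
qed

subsection \<open>Strongly elastic costs\<close>

locale strong_cost =
  fixes f :: "real \<Rightarrow> real" and \<tau> \<sigma> :: real
  assumes strong: "strongly_elastic \<tau> \<sigma> f"
    and tight: "tight_elasticity \<tau> \<sigma> f"
    and tau_le: "\<tau> \<le> \<sigma>"
    and sigma_gt: "1 < \<sigma>"
begin

abbreviation "g \<equiv> deriv f"
abbreviation "g' \<equiv> deriv (deriv f)"
abbreviation "g'' \<equiv> deriv (deriv (deriv f))"

lemma elastic: "elastic \<tau> \<sigma> f"
  using strong by (simp add: strongly_elastic_def)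

text \<open>Bridges the one-sided derivatives \<open>D n\<close> on the half-line and the iterated
  \<open>deriv\<close>, which agree at positive arguments because these are interior points.
  \<open>D\<close> is kept for the behaviour at the origin.\<close>

lemma smooth:
  obtains D :: "nat \<Rightarrow> real \<Rightarrow> real" where "\<And>y. 0 \<le> y \<Longrightarrow> D 0 y = f y"
    "\<And>n y. 0 \<le> y \<Longrightarrow> (D n has_real_derivative D (Suc n) y) (at y within {0..})"
    "\<And>y. 0 < y \<Longrightarrow> D 1 y = g y" "\<And>y. 0 < y \<Longrightarrow> (f has_real_derivative g y) (at y)"
    "\<And>y. 0 < y \<Longrightarrow> (g has_real_derivative g' y) (at y)"
    "\<And>y. 0 < y \<Longrightarrow> (g' has_real_derivative g'' y) (at y)"
    "\<And>y. 0 < y \<Longrightarrow> isCont g'' y"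
proof -
  obtain D :: "nat \<Rightarrow> real \<Rightarrow> real" where D0: "\<And>y. 0 \<le> y \<Longrightarrow> D 0 y = f y"
    and D: "\<And>n y. 0 \<le> y \<Longrightarrow> (D n has_real_derivative D (Suc n) y) (at y within {0..})"
    using elastic by (auto simp: elastic_def smooth_halfline_def)
  have D_at: "(D n has_real_derivative D (Suc n) y) (at y)" if "0 < y" for n y
  proof -
    have "y \<in> interior {0..}" using that by (simp add: interior_real_atLeast)
    from at_within_interior[OF this] D[of y n] that show ?thesis by simp
  qed
  have step: "(u has_real_derivative D (Suc n) y) (at y)"
    if "0 < y" "\<And>x. 0 < x \<Longrightarrow> D n x = u x" for n u y
    by (rule has_field_derivative_transform_within_open[OF D_at[OF that(1)], of "{0<..}"])
      (use that in auto)
  have 1: "D 1 y = g y" if "0 < y" for y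
    using DERIV_imp_deriv[OF step[of y 0 f]] that D0 by simp
  have 2: "D 2 y = g' y" if "0 < y" for y
    using DERIV_imp_deriv[OF step[of y 1 g]] that 1 by (simp add: numeral_2_eq_2)
  have 3: "D 3 y = g'' y" if "0 < y" for y
    using DERIV_imp_deriv[OF step[of y 2 g']] that 2 by (simp add: numeral_3_eq_3)
  have "isCont g'' y" if "0 < y" for y
    using step[of y 3 g''] that 3 by (auto intro: DERIV_isCont)
  then show ?thesis
    using step[of _ 0 f] step[of _ 1 g] step[of _ 2 g'] 1 2 3 D0 D
    by (intro that[of D]) (auto simp: numeral_2_eq_2 numeral_3_eq_3)
qed

lemma f_deriv: "0 < y \<Longrightarrow> (f has_real_derivative g y) (at y)"
  and g_deriv: "0 < y \<Longrightarrow> (g has_real_derivative g' y) (at y)"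
  and g'_deriv: "0 < y \<Longrightarrow> (g' has_real_derivative g'' y) (at y)"
  and g''_cont: "0 < y \<Longrightarrow> isCont g'' y"
  by (rule smooth; simp)+

text \<open>By convexity the tangent at \<open>y\<close> lies below the graph; evaluated at 0 it
  gives \<open>f y \<le> y * g y\<close>, and \<open>f y\<close> is positive.\<close>

lemma g_pos: assumes "0 < y" shows "0 < g y"
proof -
  have strict: "strictly_convex_on {0..} f" "strict_mono_on {0..} f" "f 0 = 0"
    using elastic by (auto simp: elastic_def)
  have "convex_on {0..} f"
  proof (rule convex_onI)
    fix t x y :: real
    assume *: "0 < t" "t < 1" "x \<in> {0..}" "y \<in> {0..}"
    show "f ((1 - t) *\<^sub>R x + t *\<^sub>R y) \<le> (1 - t) * f x + t * f y"
    proof (cases "x = y")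
      case False
      then show ?thesis using * strict(1) by (auto simp: strictly_convex_on_def less_imp_le)
    qed (simp add: algebra_simps)
  qed simp
  then have "g y * (0 - y) \<le> f 0 - f y"
    by (rule convex_on_imp_above_tangent)
      (use assms in \<open>auto simp: interior_real_atLeast intro!: has_field_derivative_at_within f_deriv\<close>)
  moreover have "f 0 < f y" using strict(2) assms by (auto simp: strict_mono_on_def)
  ultimately have "0 < g y * y" using strict(3) by simp
  then show ?thesis using assms by (simp add: zero_less_mult_iff)
qed

lemma g_elasticity:
  assumes "0 < y"
  shows "\<tau> - 1 \<le> elasticity g y" "elasticity g y \<le> \<sigma> - 1"
  using elastic assms by (auto simp: elastic_def)

lemma g_elasticity_mono: "0 < x \<Longrightarrow> x \<le> y \<Longrightarrow> elasticity g x \<le> elasticity g y"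
  using elastic by (auto simp: elastic_def mono_on_def)

text \<open>Tightness provides one point with elasticity below \<open>e\<close>, and monotonicity
  passes this to all smaller arguments.\<close>

lemma g_elasticity_near_origin:
  assumes "\<tau> - 1 < e"
  obtains Y where "0 < Y" "\<And>y. 0 < y \<Longrightarrow> y \<le> Y \<Longrightarrow> elasticity g y < e"
proof -
  have "bdd_below (elasticity g ` {0<..})"
    using g_elasticity(1) by (auto intro!: bdd_belowI2[where m = "\<tau> - 1"])
  moreover have "(INF y\<in>{0<..}. elasticity g y) < e"
    using tight assms by (simp add: tight_elasticity_def)
  ultimately obtain Y where "0 < Y" "elasticity g Y < e"
    by (subst (asm) cINF_less_iff) auto
  then show ?thesis using g_elasticity_mono[of _ Y] by (intro that[of Y]) (auto intro: le_less_trans)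
qed

text \<open>
  If \<open>\<tau> \<le> 1\<close>, then \<open>f'\<close> would grow at least like \<open>sqrt y\<close> at the origin, although it is
  differentiable there.
\<close>

lemma tau_gt: "1 < \<tau>"
proof (rule ccontr)
  assume "\<not> 1 < \<tau>"
  \<comment> \<open>An exponent between \<open>\<tau> - 1\<close> and 1; the value
    \<open>1 / 2\<close> allows square roots below.\<close>
  then have "\<tau> - 1 < 1 / 2" by simp
  then obtain Y where Y: "0 < Y" "\<And>y. 0 < y \<Longrightarrow> y \<le> Y \<Longrightarrow> elasticity g y < 1 / 2"
    by (rule g_elasticity_near_origin) blast
  obtain D :: "nat \<Rightarrow> real \<Rightarrow> real" where D0: "\<And>y. 0 \<le> y \<Longrightarrow> D 0 y = f y"
    and D: "\<And>n y. 0 \<le> y \<Longrightarrow> (D n has_real_derivative D (Suc n) y) (at y within {0..})"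
    and D1: "\<And>y. 0 < y \<Longrightarrow> D 1 y = g y"
    by (rule smooth) blast
  \<comment> \<open>At 0 only \<open>D 1\<close> is meaningful: \<open>deriv f 0\<close> would
    depend on the values of \<open>f\<close> at negative arguments.\<close>
  have "D 1 0 = 0"
  proof -
    have "(f has_real_derivative 0) (at 0 within {0..})"
      using elastic by (simp add: elastic_def)
    then have "(D 0 has_real_derivative 0) (at 0 within {0..})"
      by (rule has_field_derivative_transform_within[OF _ zero_less_one]) (use D0 in auto)
    then have "((\<lambda>y. (D 0 y - D 0 0) / (y - 0)) \<longlongrightarrow> 0) (at_right 0)"
      by (simp add: has_field_derivative_iff at_within_Ici_at_right)
    moreover have "((\<lambda>y. (D 0 y - D 0 0) / (y - 0)) \<longlongrightarrow> D 1 0) (at_right 0)"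
      using D[of 0 0] by (simp add: has_field_derivative_iff at_within_Ici_at_right)
    ultimately show ?thesis using tendsto_unique[OF trivial_limit_at_right_real] by blast
  qed
  then have "((\<lambda>y. D 1 y / y) \<longlongrightarrow> D 2 0) (at_right 0)"
    using D[of 0 1] by (simp add: has_field_derivative_iff at_within_Ici_at_right numeral_2_eq_2)
  \<comment> \<open>The difference quotient of \<open>D 1\<close> at 0 converges, so times
    \<open>sqrt y\<close> it tends to 0. The lower bound \<open>g Y > 0\<close> established next
    contradicts this.\<close>
  then have "((\<lambda>y. D 1 y / y * sqrt y * sqrt Y) \<longlongrightarrow> D 2 0 * sqrt 0 * sqrt Y) (at_right 0)"
    by (intro tendsto_mult tendsto_real_sqrt tendsto_ident_at tendsto_const)
  moreover have "\<forall>\<^sub>F y in at_right 0. g Y \<le> D 1 y / y * sqrt y * sqrt Y"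
    unfolding eventually_at_right_field
  proof (intro exI[of _ Y] conjI allI impI)
    fix y assume y: "0 < y" "y < Y"
    have "- g y * (Y / y) powr (1 / 2) \<le> - g Y"
    proof (rule powr_growth[where u = "\<lambda>s. - g s" and u' = "\<lambda>s. - g' s"])
      fix s assume s: "y \<le> s" "s \<le> Y"
      then have "0 < s" using y by simp
      then have "0 < g s" by (rule g_pos)
      then show "1 / 2 * - g s \<le> s * - g' s"
        using Y(2)[of s] s \<open>0 < s\<close> by (simp add: elasticity_def field_simps)
    qed (use y in \<open>auto intro!: derivative_intros g_deriv\<close>)
    then have "g Y \<le> g y * sqrt (Y / y)" using y Y(1) by (simp add: powr_half_sqrt)
    also have "\<dots> = D 1 y / y * sqrt y * sqrt Y"
    proof -
      have "sqrt (Y / y) = sqrt Y * sqrt y / y"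
        using y by (simp add: real_sqrt_divide field_simps)
      then show ?thesis unfolding D1[OF y(1)] by simp
    qed
    finally show "g Y \<le> D 1 y / y * sqrt y * sqrt Y" .
  qed (fact Y(1))
  ultimately have "g Y \<le> 0"
    using tendsto_lowerbound[OF _ _ trivial_limit_at_right_real] by fastforce
  then show False using g_pos[OF Y(1)] by simp
qed

lemma g'_pos: assumes "0 < y" shows "0 < g' y"
proof -
  have "0 < y * g' y / g y"
    using g_elasticity(1)[OF assms] tau_gt by (simp add: elasticity_def)
  then show ?thesis using assms g_pos[OF assms] by (simp add: zero_less_divide_iff zero_less_mult_iff)
qed

lemma g'_elasticity:
  assumes "0 < y"
  shows "(\<tau> - 2) * g' y \<le> y * g'' y" "y * g'' y \<le> (\<sigma> - 2) * g' y"
proof -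
  have "\<tau> - 2 \<le> y * g'' y / g' y" "y * g'' y / g' y \<le> \<sigma> - 2"
    using strong assms by (auto simp: strongly_elastic_def elasticity_def)
  then show "(\<tau> - 2) * g' y \<le> y * g'' y" "y * g'' y \<le> (\<sigma> - 2) * g' y"
    using g'_pos[OF assms] by (auto simp: field_simps)
qed

abbreviation "F \<equiv> reserve_field f"
abbreviation "\<alpha> \<equiv> alpha_star \<sigma>"
abbreviation "chi \<equiv> chi_minus \<tau> \<sigma>"

section \<open>Comparison of the reserve field with power costs\<close>

text \<open>Both bounds are instances of \<open>gap_ge_power_field\<close>: the lower one for
  \<open>g\<close> with exponent \<open>\<sigma>\<close>, the upper one for \<open>- g\<close> with
  exponent \<open>\<tau>\<close>.\<close>

lemma F_bounds:
  assumes "0 < y" "y \<le> p"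
  shows "power_field \<sigma> (p / y) \<le> F p y" "F p y \<le> power_field \<tau> (p / y)"
proof -
  have p: "0 < p" "0 < g' p" using assms g'_pos by auto
  have "p * g' p * power_field \<sigma> (p / y) \<le> g p - g y"
    by (rule gap_ge_power_field[where u'' = g''])
      (use assms sigma_gt in \<open>auto intro!: g_deriv g'_deriv g'_elasticity\<close>)
  then show "power_field \<sigma> (p / y) \<le> F p y"
    using p by (simp add: reserve_field_def pos_le_divide_eq mult_ac)
  have "p * - g' p * power_field \<tau> (p / y) \<le> - g p - - g y"
    by (rule gap_ge_power_field[where u = "\<lambda>s. - g s" and u' = "\<lambda>s. - g' s" and u'' = "\<lambda>s. - g'' s"])
      (use assms tau_gt g'_elasticity in \<open>auto intro!: derivative_intros g_deriv g'_deriv\<close>)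
  then show "F p y \<le> power_field \<tau> (p / y)"
    using p by (simp add: reserve_field_def pos_divide_le_eq mult_ac)
qed

text \<open>Sharper than the previous lower bound near the origin, where the elasticity of \<open>f'\<close> at \<open>p\<close> tends to \<open>\<tau> - 1\<close>.\<close>

lemma F_lower_bound_elasticity:
  assumes "0 < y" "y \<le> p"
  shows "(\<tau> - 1) * power_field \<tau> (p / y) / elasticity g p \<le> F p y"
proof -
  have p: "0 < p" "0 < g' p" "0 < g p" "0 < g y" using assms g'_pos g_pos by auto
  have "g y * (p / y) powr (\<tau> - 1) \<le> g p"
  proof (rule powr_growth[where u' = g'])
    fix s assume "y \<le> s" "s \<le> p"
    then have "0 < s" using assms by simp
    then show "(\<tau> - 1) * g s \<le> s * g' s"
      using g_elasticity(1)[of s] g_pos[of s] by (simp add: elasticity_def pos_le_divide_eq)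
  qed (use assms in \<open>auto intro!: g_deriv\<close>)
  then have "g y * (p / y) powr (\<tau> - 1) * (p / y) powr (1 - \<tau>) \<le> g p * (p / y) powr (1 - \<tau>)"
    by (rule mult_right_mono) simp
  then have "g y \<le> g p * (p / y) powr (1 - \<tau>)"
    using assms by (simp add: mult.assoc flip: powr_add)
  then have "(1 - (p / y) powr (1 - \<tau>)) * g p / (p * g' p) \<le> F p y"
    unfolding reserve_field_def using p by (intro divide_right_mono) (auto simp: algebra_simps)
  then show ?thesis using tau_gt by (simp add: power_field_def elasticity_def)
qed

text \<open>The right-hand side of the equation for \<open>z = \<phi> y / y\<close> in the time \<open>ln y\<close>, for the cost \<open>y powr \<tau>\<close>.\<close>

definition drift :: "real \<Rightarrow> real" where
  "drift z = \<alpha> * power_field \<tau> z - z"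

section \<open>The roots \<open>beta\<close> and \<open>chi\<close>\<close>

text \<open>Since \<open>\<alpha> = beta powr \<sigma>\<close>, both
  \<open>\<alpha> * power_field \<sigma> z - z\<close> and its derivative
  \<open>\<alpha> * z powr (- \<sigma>) - 1\<close> vanish at \<open>z = beta\<close>.\<close>

definition beta :: real where
  "beta = \<sigma> powr (1 / (\<sigma> - 1))"

lemma alpha_pos: "0 < \<alpha>"
  using sigma_gt by (simp add: alpha_star_def)

lemma beta_gt: "1 < beta"
  using sigma_gt by (simp add: beta_def)

lemma beta_fixed: "\<alpha> * power_field \<sigma> beta = beta"
proof -
  have "beta powr (1 - \<sigma>) = \<sigma> powr (1 / (\<sigma> - 1) * (1 - \<sigma>))"
    using sigma_gt by (simp add: beta_def powr_powr)
  also have "1 / (\<sigma> - 1) * (1 - \<sigma>) = - 1" using sigma_gt by (simp add: field_simps)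
  finally have "power_field \<sigma> beta = 1 / \<sigma>"
    using sigma_gt by (simp add: power_field_def powr_minus field_simps)
  moreover have "\<alpha> = \<sigma> * beta"
  proof -
    have "\<sigma> / (\<sigma> - 1) = 1 + 1 / (\<sigma> - 1)" using sigma_gt by (simp add: field_simps)
    then show ?thesis using sigma_gt by (simp add: alpha_star_def beta_def powr_add)
  qed
  ultimately show ?thesis using sigma_gt by simp
qed

text \<open>\<open>beta\<close> balances the equation for \<open>\<sigma>\<close>, and
  \<open>power_field\<close> grows when the exponent drops to \<open>\<tau>\<close>.\<close>

lemma drift_beta: "0 \<le> drift beta" "\<tau> < \<sigma> \<Longrightarrow> 0 < drift beta"
proof -
  have "power_field \<sigma> beta < power_field \<tau> beta" if "\<tau> < \<sigma>"
    using power_field_strict_antimono_exponent[of \<tau> \<sigma> beta] that tau_gt beta_gt by simp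
  then show "\<tau> < \<sigma> \<Longrightarrow> 0 < drift beta"
    using alpha_pos beta_fixed unfolding drift_def by (metis diff_gt_0_iff_gt mult_less_cancel_left_pos)
  then show "0 \<le> drift beta"
    unfolding drift_def using tau_le beta_fixed by (cases "\<tau> = \<sigma>") auto
qed

lemma drift_continuous: "A \<subseteq> {0<..} \<Longrightarrow> continuous_on A drift"
  unfolding drift_def using tau_gt by (intro continuous_intros power_field_continuous) auto

text \<open>The left-hand expression is \<open>drift z\<close> times the nonzero factor
  \<open>- (z powr (\<tau> - 1))\<close>.\<close>

lemma chi_equation_iff:
  assumes "0 < z"
  shows "z powr \<tau> - \<alpha> / (\<tau> - 1) * (z powr (\<tau> - 1) - 1) = 0 \<longleftrightarrow> drift z = 0"
proof -
  have "z powr (\<tau> - 1) * z powr (1 - \<tau>) = 1" using assms by (simp flip: powr_add)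
  moreover have "z powr \<tau> = z powr (\<tau> - 1) * z" using assms by (simp add: powr_diff)
  ultimately have "z powr \<tau> - \<alpha> / (\<tau> - 1) * (z powr (\<tau> - 1) - 1) = - (z powr (\<tau> - 1) * drift z)"
    by (simp add: drift_def power_field_def algebra_simps diff_divide_distrib)
  then show ?thesis using assms by simp
qed

text \<open>\<open>drift\<close> is -1 at 1 and non-negative at \<open>beta\<close>, so it has roots
  in between, and the set of these has a least element. Positive numbers below 1 are no roots, as
  \<open>power_field \<tau>\<close> is not positive there; hence the \<open>LEAST\<close> in
  \<open>chi_minus\<close> exists. An earlier sign change would give a smaller root.\<close>

lemma chi_properties: "1 < chi" "chi \<le> beta" "drift chi = 0"
  and drift_neg: "\<And>z. 1 \<le> z \<Longrightarrow> z < chi \<Longrightarrow> drift z < 0"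
proof -
  define R where "R = {z \<in> {1..beta}. drift z = 0}"
  have drift_1: "drift 1 = - 1" by (simp add: drift_def)
  have cont: "continuous_on {1..b} drift" for b by (rule drift_continuous) auto
  have "closed R"
    unfolding R_def by (intro continuous_closed_preimage_constant cont) auto
  moreover have "R \<noteq> {}"
    using IVT'[of drift 1 0 beta] drift_beta(1) beta_gt cont drift_1 by (auto simp: R_def)
  moreover have bdd: "bdd_below R" by (auto simp: R_def intro!: bdd_belowI[of _ 1])
  ultimately have Inf_R: "Inf R \<in> R" by (simp add: closed_contains_Inf)
  have "chi = Inf R"
    unfolding chi_minus_def
  proof (rule Least_equality)
    show "0 < Inf R \<and> Inf R powr \<tau> - \<alpha> / (\<tau> - 1) * (Inf R powr (\<tau> - 1) - 1) = 0"
    proof -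
      have "0 < Inf R" "drift (Inf R) = 0" using Inf_R by (auto simp: R_def)
      then show ?thesis using chi_equation_iff by simp
    qed
  next
    fix z assume z: "0 < z \<and> z powr \<tau> - \<alpha> / (\<tau> - 1) * (z powr (\<tau> - 1) - 1) = 0"
    then have "drift z = 0" using chi_equation_iff by blast
    have "1 \<le> z"
    proof (rule ccontr)
      assume "\<not> 1 \<le> z"
      then have "1 \<le> z powr (1 - \<tau>)"
        using z tau_gt powr_mono'[of "1 - \<tau>" 0 z] by simp
      then have "\<alpha> * power_field \<tau> z \<le> 0"
        using alpha_pos tau_gt
        by (intro mult_nonneg_nonpos) (auto simp: power_field_def divide_nonpos_pos)
      then show False using \<open>drift z = 0\<close> z by (simp add: drift_def)
    qed
    show "Inf R \<le> z"
    proof (cases "z \<le> beta")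
      case True
      then show ?thesis using \<open>1 \<le> z\<close> \<open>drift z = 0\<close> bdd by (intro cInf_lower) (auto simp: R_def)
    next
      case False
      then show ?thesis using Inf_R by (auto simp: R_def)
    qed
  qed
  with Inf_R show le: "chi \<le> beta" and zero: "drift chi = 0" by (auto simp: R_def)
  have "chi \<noteq> 1" using zero drift_1 by auto
  then show "1 < chi" using Inf_R \<open>chi = Inf R\<close> by (auto simp: R_def)
  show "drift z < 0" if z: "1 \<le> z" "z < chi" for z
  proof (rule ccontr)
    assume "\<not> drift z < 0"
    then obtain x where x: "1 \<le> x" "x \<le> z" "drift x = 0"
      using IVT'[of drift 1 0 z] z cont drift_1 by auto
    then have "x \<in> R" using z le by (auto simp: R_def)
    then have "chi \<le> x" using bdd \<open>chi = Inf R\<close> by (simp add: cInf_lower)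
    then show False using x z by simp
  qed
qed

text \<open>By concavity \<open>drift\<close> lies above the chord from its zero at
  \<open>chi\<close> to its value at \<open>beta\<close>. If the two points coincide, any
  \<open>\<kappa>\<close> serves.\<close>

lemma drift_pos_linear:
  obtains \<kappa> where "0 < \<kappa>" "\<And>z. chi \<le> z \<Longrightarrow> z \<le> beta \<Longrightarrow> \<kappa> * (z - chi) \<le> drift z"
proof (cases "chi = beta")
  case True
  show ?thesis by (rule that[of 1]) (use True chi_properties(3) in auto)
next
  case False
  then have lt: "chi < beta" using chi_properties(2) by simp
  \<comment> \<open>For \<open>\<tau> = \<sigma>\<close> the function \<open>drift\<close> would
    increase strictly up to \<open>beta\<close>, yet vanish at both \<open>chi\<close> and
    \<open>beta\<close>.\<close>
  have "\<tau> < \<sigma>"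
  proof (rule ccontr)
    assume "\<not> \<tau> < \<sigma>"
    then have eq: "\<tau> = \<sigma>" using tau_le by simp
    have "drift chi < drift beta"
    proof (rule DERIV_pos_imp_increasing_open[OF lt])
      fix z assume z: "chi < z" "z < beta"
      then have "0 < z" using chi_properties(1) by simp
      have "(drift has_real_derivative \<alpha> * z powr (- \<tau>) - 1) (at z)"
        unfolding drift_def[abs_def] using \<open>0 < z\<close> tau_gt
        by (intro DERIV_diff DERIV_cmult power_field_deriv DERIV_ident) auto
      moreover have "1 < \<alpha> * z powr (- \<sigma>)"
      proof -
        have "\<alpha> = beta powr \<sigma>" by (simp add: alpha_star_def beta_def powr_powr)
        moreover have "z powr \<sigma> < beta powr \<sigma>"
          using z \<open>0 < z\<close> sigma_gt by (intro powr_less_mono2) auto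
        ultimately show ?thesis using \<open>0 < z\<close> by (simp add: powr_minus field_simps)
      qed
      ultimately show "\<exists>d. (drift has_real_derivative d) (at z) \<and> 0 < d" unfolding eq by auto
    qed (use chi_properties(1) in \<open>auto intro!: drift_continuous\<close>)
    moreover have "drift beta = 0" unfolding drift_def using beta_fixed by (simp add: eq)
    ultimately show False using chi_properties(3) by simp
  qed
  have concave: "concave_on {1..beta} drift"
    unfolding drift_def using tau_gt alpha_pos
    by (intro concave_on_diff concave_on_cmul power_field_concave convex_on_ident[THEN iffD2]) auto
  show ?thesis
  proof (rule that[of "drift beta / (beta - chi)"])
    show "0 < drift beta / (beta - chi)" using lt drift_beta(2)[OF \<open>\<tau> < \<sigma>\<close>] by simp
    fix z assume z: "chi \<le> z" "z \<le> beta"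
    define t where "t = (z - chi) / (beta - chi)"
    have "t * (beta - chi) = z - chi" using lt by (simp add: t_def)
    then have "(1 - t) * chi + t * beta = z" by (simp add: algebra_simps)
    moreover have "0 \<le> t" "t \<le> 1" using z lt by (auto simp: t_def)
    ultimately have "(1 - t) * drift chi + t * drift beta \<le> drift z"
      using concave_onD[OF concave, of t chi beta] chi_properties lt by simp
    then show "drift beta / (beta - chi) * (z - chi) \<le> drift z"
      using chi_properties(3) by (simp add: t_def mult_ac)
  qed
qed

section \<open>Regularity of the reserve field\<close>

text \<open>The derivative is expressed through \<open>F\<close> itself and the elasticity of
  \<open>f''\<close>, the two quantities for which bounds are known.\<close>

lemma F_deriv:
  assumes "0 < p"
  shows "((\<lambda>p. F p y) has_real_derivative (1 - F p y * (1 + p * g'' p / g' p)) / p) (at p)"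
proof -
  have "((\<lambda>p. (g p - g y) / (p * g' p)) has_real_derivative
      (g' p * (p * g' p) - (g p - g y) * (g' p + p * g'' p)) / (p * g' p * (p * g' p))) (at p)"
    using assms g'_pos[OF assms]
    by (auto intro!: derivative_eq_intros g_deriv g'_deriv simp: algebra_simps)
  moreover have "(g' p * (p * g' p) - (g p - g y) * (g' p + p * g'' p)) / (p * g' p * (p * g' p))
      = (1 - F p y * (1 + p * g'' p / g' p)) / p"
    using assms g'_pos[OF assms] by (simp add: reserve_field_def field_simps)
  ultimately show ?thesis by (simp add: reserve_field_def[abs_def])
qed

lemma continuous_on_g: "A \<subseteq> {0<..} \<Longrightarrow> continuous_on A g"
  and continuous_on_g': "A \<subseteq> {0<..} \<Longrightarrow> continuous_on A g'"
  and continuous_on_g'': "A \<subseteq> {0<..} \<Longrightarrow> continuous_on A g''"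
  using g_deriv g'_deriv g''_cont
  by (auto intro!: continuous_at_imp_continuous_on intro: DERIV_isCont)

lemma continuous_on_F [continuous_intros]:
  assumes "continuous_on A u" "continuous_on A v" "\<And>x. x \<in> A \<Longrightarrow> 0 < u x" "\<And>x. x \<in> A \<Longrightarrow> 0 < v x"
  shows "continuous_on A (\<lambda>x. F (u x) (v x))"
proof -
  have "continuous_on A (\<lambda>x. g (u x))" "continuous_on A (\<lambda>x. g (v x))" "continuous_on A (\<lambda>x. g' (u x))"
    by (rule continuous_on_compose2[OF continuous_on_g[OF order_refl]]
        continuous_on_compose2[OF continuous_on_g'[OF order_refl]]; use assms in force)+
  moreover have "\<forall>x\<in>A. u x * g' (u x) \<noteq> 0" using assms(3) g'_pos by fastforce
  ultimately show ?thesis unfolding reserve_field_def by (intro continuous_intros assms(1))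
qed

text \<open>In terms of the ratio the derivative is \<open>(1 - F * E) / x\<close> with
  \<open>0 \<le> F \<le> 1 / (\<tau> - 1)\<close> and
  \<open>\<tau> - 1 \<le> E \<le> \<sigma> - 1\<close>. The constant does not depend on
  \<open>y\<close>, so the ratio equation is Lipschitz uniformly in time.\<close>

lemma F_Lipschitz_ratio:
  assumes "0 < y" "1 \<le> x" "1 \<le> z"
  shows "\<bar>F (x * y) y - F (z * y) y\<bar> \<le> (\<sigma> - 1) / (\<tau> - 1) * \<bar>x - z\<bar>"
proof -
  have "norm (F (x * y) y - F (z * y) y) \<le> (\<sigma> - 1) / (\<tau> - 1) * norm (x - z)"
  proof (rule field_differentiable_bound[where S = "{1..}" and f = "\<lambda>x. F (x * y) y"])
    fix x :: real assume "x \<in> {1..}"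
    then have x: "1 \<le> x" by simp
    define p where "p = x * y"
    define E where "E = 1 + p * g'' p / g' p"
    have p: "0 < p" "y \<le> p" "p / y = x" using x assms(1) by (auto simp: p_def)
    have E: "\<tau> - 1 \<le> E" "E \<le> \<sigma> - 1"
      using g'_elasticity[OF p(1)] g'_pos[OF p(1)] by (auto simp: E_def field_simps)
    have F: "0 \<le> F p y" "F p y \<le> 1 / (\<tau> - 1)"
      using F_bounds[OF assms(1) p(2)] power_field_bounds[OF sigma_gt x]
        power_field_bounds[OF tau_gt x] p by auto
    have "((\<lambda>x. F (x * y) y) has_real_derivative (1 - F p y * E) / p * y) (at x)"
      unfolding E_def
      by (rule DERIV_chain2[where g = "\<lambda>x. x * y" and f = "\<lambda>p. F p y"])
        (use F_deriv[OF p(1)] in \<open>auto simp: p_def intro!: derivative_eq_intros\<close>)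
    moreover have eq: "(1 - F p y * E) / p * y = (1 - F p y * E) / x"
      using assms(1) by (simp add: p_def)
    ultimately show "((\<lambda>x. F (x * y) y) has_real_derivative (1 - F p y * E) / x) (at x within {1..})"
      by (simp add: has_field_derivative_at_within)
    have "0 \<le> F p y * E" using F E tau_gt by simp
    moreover have "F p y * E \<le> 1 / (\<tau> - 1) * (\<sigma> - 1)"
      using F E tau_gt by (intro mult_mono) auto
    moreover have "1 \<le> (\<sigma> - 1) / (\<tau> - 1)" using tau_gt tau_le by simp
    ultimately have "\<bar>1 - F p y * E\<bar> \<le> (\<sigma> - 1) / (\<tau> - 1)" by simp
    moreover have "\<bar>1 - F p y * E\<bar> / x \<le> \<bar>1 - F p y * E\<bar>" 
      using x mult_left_mono[of 1 x "\<bar>1 - F p y * E\<bar>"] by (simp add: pos_divide_le_eq)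
    ultimately show "norm ((1 - F (x * y) y * (1 + x * y * g'' (x * y) / g' (x * y))) / x) \<le> (\<sigma> - 1) / (\<tau> - 1)"
      using x by (simp add: p_def E_def)
  qed (use assms in auto)
  then show ?thesis by simp
qed

subsection \<open>The equation for the ratio\<close>

text \<open>
  Clipping makes the field bounded and globally Lipschitz; it has no effect on ratios in
  \<open>[1, beta]\<close>, where the relevant solutions stay.
\<close>

definition clip :: "real \<Rightarrow> real" where
  "clip z = max 1 (min beta z)"

lemma clip: "1 \<le> clip z" "clip z \<le> beta" "\<bar>clip x - clip z\<bar> \<le> \<bar>x - z\<bar>"
  "1 \<le> z \<Longrightarrow> z \<le> beta \<Longrightarrow> clip z = z"
  using beta_gt by (auto simp: clip_def)

definition ratio_field :: "real \<Rightarrow> real \<Rightarrow> real" where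
  "ratio_field t z = \<alpha> * F (clip z * exp t) (exp t) - clip z"

definition ratio_Lipschitz :: real where
  "ratio_Lipschitz = \<alpha> * ((\<sigma> - 1) / (\<tau> - 1)) + 1"

lemma ratio_field_Lipschitz: "\<bar>ratio_field t x - ratio_field t z\<bar> \<le> ratio_Lipschitz * \<bar>x - z\<bar>"
proof -
  let ?K = "(\<sigma> - 1) / (\<tau> - 1)"
  have "\<bar>F (clip x * exp t) (exp t) - F (clip z * exp t) (exp t)\<bar> \<le> ?K * \<bar>clip x - clip z\<bar>"
    by (rule F_Lipschitz_ratio) (use clip in auto)
  then have "\<alpha> * \<bar>F (clip x * exp t) (exp t) - F (clip z * exp t) (exp t)\<bar> \<le> \<alpha> * (?K * \<bar>clip x - clip z\<bar>)"
    using alpha_pos by (intro mult_left_mono) auto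
  then have "\<bar>\<alpha> * F (clip x * exp t) (exp t) - \<alpha> * F (clip z * exp t) (exp t)\<bar> \<le> \<alpha> * ?K * \<bar>clip x - clip z\<bar>"
    using alpha_pos by (simp add: abs_mult mult_ac flip: right_diff_distrib)
  then have "\<bar>ratio_field t x - ratio_field t z\<bar> \<le> ratio_Lipschitz * \<bar>clip x - clip z\<bar>"
    using abs_triangle_ineq4[of "\<alpha> * F (clip x * exp t) (exp t) - \<alpha> * F (clip z * exp t) (exp t)" "clip x - clip z"]
    unfolding ratio_field_def ratio_Lipschitz_def distrib_right by (simp add: algebra_simps)
  also have "\<dots> \<le> ratio_Lipschitz * \<bar>x - z\<bar>"
    using alpha_pos sigma_gt tau_gt clip(3) by (intro mult_left_mono) (auto simp: ratio_Lipschitz_def)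
  finally show ?thesis .
qed

lemma ratio_Lipschitz_pos: "0 < ratio_Lipschitz"
  using alpha_pos sigma_gt tau_gt by (auto simp: ratio_Lipschitz_def intro!: add_nonneg_pos)

lemma F_clip_bounds: "0 \<le> F (clip z * exp t) (exp t)" "F (clip z * exp t) (exp t) \<le> 1 / (\<tau> - 1)"
  using F_bounds[of "exp t" "clip z * exp t"] clip(1)[of z]
    power_field_bounds[OF sigma_gt clip(1)[of z]] power_field_bounds[OF tau_gt clip(1)[of z]]
  by (auto simp: mult_le_cancel_right1)

lemma ratio_field_bounded: "\<bar>ratio_field t z\<bar> \<le> \<alpha> / (\<tau> - 1) + beta"
proof -
  have "\<alpha> * F (clip z * exp t) (exp t) \<le> \<alpha> * (1 / (\<tau> - 1))"
    using F_clip_bounds(2)[of z t] alpha_pos by (intro mult_left_mono) auto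
  moreover have "0 \<le> \<alpha> * F (clip z * exp t) (exp t)"
    using F_clip_bounds(1)[of z t] alpha_pos by simp
  ultimately show ?thesis using clip(1,2)[of z] unfolding ratio_field_def by simp
qed

lemma ratio_field_continuous: "continuous_on UNIV (\<lambda>(t, z). ratio_field t z)"
  unfolding ratio_field_def case_prod_beta
proof (intro continuous_intros)
  show "continuous_on UNIV (\<lambda>x :: real \<times> real. clip (snd x))"
    and "continuous_on UNIV (\<lambda>x :: real \<times> real. clip (snd x))"
    unfolding clip_def by (intro continuous_intros)+
  show "0 < clip (snd x) * exp (fst x)" for x :: "real \<times> real"
    using clip(1)[of "snd x"] by simp
qed auto

text \<open>On ratios in \<open>[1, beta]\<close> the field is at most \<open>drift\<close>, which
  vanishes at \<open>chi\<close>.\<close>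

lemma ratio_field_chi: "ratio_field t chi \<le> 0"
proof -
  have "F (chi * exp t) (exp t) \<le> power_field \<tau> chi"
    using F_bounds(2)[of "exp t" "chi * exp t"] chi_properties(1) by simp
  then have "\<alpha> * F (chi * exp t) (exp t) \<le> \<alpha> * power_field \<tau> chi"
    using alpha_pos by simp
  then show ?thesis
    using chi_properties clip(4)[of chi] by (simp add: ratio_field_def drift_def)
qed

lemma ratio_field_beta: "0 \<le> ratio_field t beta"
proof -
  have "power_field \<sigma> beta \<le> F (beta * exp t) (exp t)"
    using F_bounds(1)[of "exp t" "beta * exp t"] beta_gt by simp
  then have "\<alpha> * power_field \<sigma> beta \<le> \<alpha> * F (beta * exp t) (exp t)"
    using alpha_pos by simp
  then show ?thesis using beta_fixed beta_gt clip(4)[of beta] by (simp add: ratio_field_def)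
qed

text \<open>Expresses \<open>F \<ge> 0\<close>, that is, that the reserve function does not
  decrease.\<close>

lemma ratio_field_ge_neg: "1 \<le> z \<Longrightarrow> z \<le> beta \<Longrightarrow> - z \<le> ratio_field t z"
  using F_clip_bounds(1)[of z t] alpha_pos clip(4)[of z] by (simp add: ratio_field_def)

section \<open>Global solutions of the ratio equation and their barriers\<close>

definition ratio_solution :: "(real \<Rightarrow> real) \<Rightarrow> bool" where
  "ratio_solution z \<longleftrightarrow> (\<forall>t. (z has_real_derivative ratio_field t (z t)) (at t))"

lemma ratio_solution_exists:
  obtains z where "ratio_solution z" "z t0 = z0"
  using bounded_Lipschitz_solution_exists[OF ratio_field_continuous ratio_field_bounded
      ratio_field_Lipschitz ratio_Lipschitz_pos]
  unfolding ratio_solution_def by metis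

lemma ratio_solution_continuous: "ratio_solution z \<Longrightarrow> continuous_on A z"
  unfolding ratio_solution_def
  by (rule DERIV_continuous_on) (auto intro: has_field_derivative_at_within)

text \<open>Beyond a barrier the field differs from its value on the barrier by at most the
  Lipschitz constant times the distance. The sign on the barrier then yields the inequality required
  by \<open>nonpos_forward\<close> or \<open>nonpos_backward\<close>.\<close>

lemma ratio_solution_barriers:
  assumes z: "ratio_solution z" "z t0 = chi"
  shows "t \<le> t0 \<Longrightarrow> chi \<le> z t" "t \<le> t0 \<Longrightarrow> z t \<le> beta" "t0 \<le> t \<Longrightarrow> z t \<le> chi"
    "t0 \<le> t \<Longrightarrow> t \<le> t0 + ln chi \<Longrightarrow> chi * exp (t0 - t) \<le> z t"
proof -
  note deriv = z(1)[unfolded ratio_solution_def, rule_format]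
  note cont = ratio_solution_continuous[OF z(1)]
  have lips: "ratio_field s (z s) \<le> ratio_field s c + ratio_Lipschitz * \<bar>z s - c\<bar>"
    "ratio_field s c - ratio_Lipschitz * \<bar>z s - c\<bar> \<le> ratio_field s (z s)" for s c
    using ratio_field_Lipschitz[of s "z s" c] by (auto simp: abs_le_iff)
  show "chi \<le> z t" if "t \<le> t0"
  proof -
    have "chi - z t \<le> 0"
    proof (rule nonpos_backward[where L = ratio_Lipschitz, OF that])
      fix s assume "0 < chi - z s"
      then show "\<exists>d. ((\<lambda>s. chi - z s) has_real_derivative d) (at s) \<and> - ratio_Lipschitz * (chi - z s) \<le> d"
        using lips(1)[of s chi] ratio_field_chi[of s]
        by (intro exI[of _ "- ratio_field s (z s)"] conjI) (auto intro!: derivative_eq_intros deriv)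
    qed (use z(2) in \<open>auto intro!: continuous_intros cont\<close>)
    then show ?thesis by simp
  qed
  show "z t \<le> beta" if "t \<le> t0"
  proof -
    have "z t - beta \<le> 0"
    proof (rule nonpos_backward[where L = ratio_Lipschitz, OF that])
      fix s assume "0 < z s - beta"
      then show "\<exists>d. ((\<lambda>s. z s - beta) has_real_derivative d) (at s) \<and> - ratio_Lipschitz * (z s - beta) \<le> d"
        using lips(2)[of s beta] ratio_field_beta[of s]
        by (intro exI[of _ "ratio_field s (z s)"] conjI) (auto intro!: derivative_eq_intros deriv)
    qed (use z(2) chi_properties(2) in \<open>auto intro!: continuous_intros cont\<close>)
    then show ?thesis by simp
  qed
  show upper: "z t \<le> chi" if "t0 \<le> t" for t
  proof -
    have "z t - chi \<le> 0"
    proof (rule nonpos_forward[where L = ratio_Lipschitz, OF that])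
      fix s assume "0 < z s - chi"
      then show "\<exists>d. ((\<lambda>s. z s - chi) has_real_derivative d) (at s) \<and> d \<le> ratio_Lipschitz * (z s - chi)"
        using lips(1)[of s chi] ratio_field_chi[of s]
        by (intro exI[of _ "ratio_field s (z s)"] conjI) (auto intro!: derivative_eq_intros deriv)
    qed (use z(2) in \<open>auto intro!: continuous_intros cont\<close>)
    then show ?thesis by simp
  qed
  \<comment> \<open>This moving barrier is the ratio of the constant reserve
    \<open>chi * exp t0\<close>. It stays in \<open>[1, beta]\<close>, where clipping has no effect,
    until it reaches 1 at time \<open>t0 + ln chi\<close>.\<close>
  show "chi * exp (t0 - t) \<le> z t" if t: "t0 \<le> t" "t \<le> t0 + ln chi"
  proof -
    have "chi * exp (t0 - t) - z t \<le> 0"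
    proof (rule nonpos_forward[where L = ratio_Lipschitz, OF t(1)])
      fix s assume s: "t0 < s" "s < t" "0 < chi * exp (t0 - s) - z s"
      let ?p = "chi * exp (t0 - s)"
      have "s - t0 \<le> ln chi" using s t by simp
      then have "exp (s - t0) \<le> chi" using chi_properties(1) by (metis exp_le_cancel_iff exp_ln less_trans zero_less_one)
      then have "exp (s - t0) * exp (t0 - s) \<le> ?p" by (intro mult_right_mono) auto
      then have "1 \<le> ?p" by (simp flip: exp_add)
      moreover have "?p \<le> beta"
      proof -
        have "?p \<le> chi * 1" using s chi_properties(1) by (intro mult_left_mono) auto
        then show ?thesis using chi_properties(2) by simp
      qed
      ultimately have "- ?p \<le> ratio_field s ?p" by (rule ratio_field_ge_neg)
      then show "\<exists>d. ((\<lambda>s. chi * exp (t0 - s) - z s) has_real_derivative d) (at s) \<and>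
          d \<le> ratio_Lipschitz * (?p - z s)"
        using lips(2)[of s ?p] s
        by (intro exI[of _ "- ?p - ratio_field s (z s)"] conjI)
          (auto intro!: derivative_eq_intros deriv)
    qed (use z(2) in \<open>auto intro!: continuous_intros cont\<close>)
    then show ?thesis by simp
  qed
qed

section \<open>Comparison and uniqueness of solutions\<close>

lemma F_Lipschitz_compact:
  assumes "0 < a" "0 < m"
  obtains L where "\<And>y p q. y \<in> {a..b} \<Longrightarrow> p \<in> {m..M} \<Longrightarrow> q \<in> {m..M} \<Longrightarrow>
    \<bar>F p y - F q y\<bar> \<le> L * \<bar>p - q\<bar>"
proof -
  define G where "G p y = (1 - F p y * (1 + p * g'' p / g' p)) / p" for p y
  have "continuous_on ({m..M} \<times> {a..b}) (\<lambda>x. G (fst x) (snd x))"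
    unfolding G_def
  proof (intro continuous_intros)
    show "continuous_on ({m..M} \<times> {a..b}) (\<lambda>x. g'' (fst x))"
      by (rule continuous_on_compose2[OF continuous_on_g''[OF order_refl]])
        (use assms in \<open>auto intro!: continuous_intros\<close>)
    show "continuous_on ({m..M} \<times> {a..b}) (\<lambda>x. g' (fst x))"
      by (rule continuous_on_compose2[OF continuous_on_g'[OF order_refl]])
        (use assms in \<open>auto intro!: continuous_intros\<close>)
    show "\<forall>x\<in>{m..M} \<times> {a..b}. g' (fst x) \<noteq> 0"
      using assms g'_pos by (auto simp: less_le)
  qed (use assms in auto)
  then have "compact ((\<lambda>x. G (fst x) (snd x)) ` ({m..M} \<times> {a..b}))"
    by (rule compact_continuous_image) (rule compact_Times[OF compact_Icc compact_Icc])
  then obtain B where "\<forall>x\<in>{m..M} \<times> {a..b}. norm (G (fst x) (snd x)) \<le> B"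
    by (drule_tac compact_imp_bounded) (auto simp only: bounded_iff ball_simps)
  then have B: "norm (G p y) \<le> B" if "p \<in> {m..M}" "y \<in> {a..b}" for p y
    using that by (metis SigmaI fst_conv snd_conv)
  show ?thesis
  proof (rule that[of B])
    fix y p q assume *: "y \<in> {a..b}" "p \<in> {m..M}" "q \<in> {m..M}"
    have "norm (F p y - F q y) \<le> B * norm (p - q)"
    proof (rule field_differentiable_bound[where S = "{m..M}" and f = "\<lambda>p. F p y" and f' = "\<lambda>p. G p y"])
      show "((\<lambda>p. F p y) has_real_derivative G z y) (at z within {m..M})" if "z \<in> {m..M}" for z
        unfolding G_def using that assms(2) by (intro has_field_derivative_at_within[OF F_deriv]) auto
      show "norm (G z y) \<le> B" if "z \<in> {m..M}" for z using B that *(1) by blast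
    qed (use *(2,3) in simp_all)
    then show "\<bar>F p y - F q y\<bar> \<le> B * \<bar>p - q\<bar>" by simp
  qed
qed

text \<open>Common form of \<open>solution_on\<close> and \<open>competitive_on\<close> away from
  the origin; two-sided derivatives are asked only in the interior, so endpoints of the domain cause
  no trouble.\<close>

definition solution_arc :: "real \<Rightarrow> real \<Rightarrow> (real \<Rightarrow> real) \<Rightarrow> bool" where
  "solution_arc a b \<phi> \<longleftrightarrow> continuous_on {a..b} \<phi> \<and> (\<forall>y\<in>{a..b}. 0 < \<phi> y) \<and>
    (\<forall>y. a < y \<and> y < b \<longrightarrow> (\<phi> has_real_derivative \<alpha> * F (\<phi> y) y) (at y))"

lemma solution_arcI:
  assumes "{a..b} \<subseteq> J" "continuous_on J \<phi>" "\<And>y. y \<in> {a..b} \<Longrightarrow> 0 < \<phi> y"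
    and der: "\<And>y. y \<in> {a..b} \<Longrightarrow> (\<phi> has_real_derivative \<alpha> * F (\<phi> y) y) (at y within J)"
  shows "solution_arc a b \<phi>"
  unfolding solution_arc_def
proof (intro conjI ballI allI impI)
  show "continuous_on {a..b} \<phi>" using assms(1,2) by (rule continuous_on_subset[rotated])
  fix y assume y: "a < y \<and> y < b"
  then have "(\<phi> has_real_derivative \<alpha> * F (\<phi> y) y) (at y within {a<..<b})"
    by (intro has_field_derivative_subset[OF der]) (use assms(1) in auto)
  moreover have "at y within {a<..<b} = at y" using y by (intro at_within_open) auto
  ultimately show "(\<phi> has_real_derivative \<alpha> * F (\<phi> y) y) (at y)" by simp
next
  fix y assume "y \<in> {a..b}"
  then show "0 < \<phi> y" by (rule assms(3))
qed

lemma solution_on_arc: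
  assumes "solution_on f \<alpha> J \<phi>" "a \<in> J" "b \<in> J" "0 < a"
  shows "solution_arc a b \<phi>"
proof -
  have J: "is_interval J" "continuous_on J \<phi>"
    "\<And>y. y \<in> J \<Longrightarrow> 0 < y \<Longrightarrow> 0 < \<phi> y \<and> (\<phi> has_real_derivative \<alpha> * F (\<phi> y) y) (at y within J)"
    using assms(1) by (simp_all add: solution_on_def)
  have sub: "{a..b} \<subseteq> J"
    using mem_is_interval_1_I[OF J(1) assms(2,3)] by (intro subsetI) simp
  have "0 < \<phi> y \<and> (\<phi> has_real_derivative \<alpha> * F (\<phi> y) y) (at y within J)" if "y \<in> {a..b}" for y
    using that sub assms(4) by (intro J(3)) auto
  then show ?thesis by (intro solution_arcI[OF sub J(2)]) blast+
qed

lemma competitive_on_arc: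
  assumes "competitive_on f \<alpha> {0..} \<phi>" "0 < a"
  shows "solution_arc a b \<phi>"
proof (rule solution_arcI[where J = "{0..}"])
  show "continuous_on {0..} \<phi>" using assms(1) by (simp add: competitive_on_def)
  fix y assume "y \<in> {a..b}"
  then have y: "0 < y" "y \<in> {0..}" using assms(2) by auto
  then have "y \<le> \<phi> y" using assms(1) unfolding competitive_on_def by blast
  then show "0 < \<phi> y" using y by simp
  show "(\<phi> has_real_derivative \<alpha> * F (\<phi> y) y) (at y within {0..})"
    using assms(1) y by (auto simp: competitive_on_def)
qed (use assms(2) in auto)

text \<open>Both solutions stay in one compact box, where \<open>F\<close> is Lipschitz in its first
  argument; the positive part of the difference therefore obeys a linear differential inequality in
  both time directions. Applied both ways round, this is uniqueness.\<close>

lemma solution_arc_mono: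
  assumes "0 < a" "a \<le> b" and arcs: "solution_arc a b \<phi>" "solution_arc a b \<psi>"
  shows "\<phi> a \<le> \<psi> a \<Longrightarrow> \<phi> b \<le> \<psi> b" "\<phi> b \<le> \<psi> b \<Longrightarrow> \<phi> a \<le> \<psi> a"
proof -
  have cont: "continuous_on {a..b} \<phi>" "continuous_on {a..b} \<psi>"
    and pos: "\<And>y. y \<in> {a..b} \<Longrightarrow> 0 < \<phi> y" "\<And>y. y \<in> {a..b} \<Longrightarrow> 0 < \<psi> y"
    using arcs by (auto simp: solution_arc_def)
  have range: "\<exists>m M. 0 < m \<and> (\<forall>y\<in>{a..b}. u y \<in> {m..M})"
    if u: "continuous_on {a..b} u" "\<And>y. y \<in> {a..b} \<Longrightarrow> 0 < u y" for u :: "real \<Rightarrow> real"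
  proof -
    have ne: "{a..b} \<noteq> {}" using assms(2) by simp
    obtain x where x: "x \<in> {a..b}" "\<forall>t\<in>{a..b}. u x \<le> u t"
      using continuous_attains_inf[OF compact_Icc ne u(1)] by blast
    obtain y where y: "y \<in> {a..b}" "\<forall>t\<in>{a..b}. u t \<le> u y"
      using continuous_attains_sup[OF compact_Icc ne u(1)] by blast
    show ?thesis
    proof (intro exI conjI ballI)
      show "0 < u x" by (rule u(2)[OF x(1)])
      show "u t \<in> {u x..u y}" if "t \<in> {a..b}" for t using x y that by simp
    qed
  qed
  obtain m1 M1 m2 M2 where mM: "0 < m1" "\<forall>y\<in>{a..b}. \<phi> y \<in> {m1..M1}"
    "0 < m2" "\<forall>y\<in>{a..b}. \<psi> y \<in> {m2..M2}"
    using range[OF cont(1) pos(1)] range[OF cont(2) pos(2)] by blast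
  obtain L where L: "\<And>y p q. y \<in> {a..b} \<Longrightarrow> p \<in> {min m1 m2..max M1 M2} \<Longrightarrow>
      q \<in> {min m1 m2..max M1 M2} \<Longrightarrow> \<bar>F p y - F q y\<bar> \<le> L * \<bar>p - q\<bar>"
    using F_Lipschitz_compact[of a "min m1 m2" b "max M1 M2"] assms(1) mM by auto
  define w where "w y = \<phi> y - \<psi> y" for y
  have w_cont: "continuous_on {a..b} w" unfolding w_def by (intro continuous_intros cont)
  have w_deriv: "\<exists>d. (w has_real_derivative d) (at y) \<and> \<bar>d\<bar> \<le> \<alpha> * L * w y"
    if y: "a < y" "y < b" "0 < w y" for y
  proof (intro exI conjI)
    show "(w has_real_derivative \<alpha> * F (\<phi> y) y - \<alpha> * F (\<psi> y) y) (at y)"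
      unfolding w_def using arcs y by (intro DERIV_diff) (auto simp: solution_arc_def)
    have "\<phi> y \<in> {m1..M1}" "\<psi> y \<in> {m2..M2}" using mM y by auto
    then have "\<bar>F (\<phi> y) y - F (\<psi> y) y\<bar> \<le> L * \<bar>\<phi> y - \<psi> y\<bar>"
      using y by (intro L) auto
    then have "\<alpha> * \<bar>F (\<phi> y) y - F (\<psi> y) y\<bar> \<le> \<alpha> * (L * w y)"
      using y alpha_pos by (intro mult_left_mono) (auto simp: w_def)
    then show "\<bar>\<alpha> * F (\<phi> y) y - \<alpha> * F (\<psi> y) y\<bar> \<le> \<alpha> * L * w y"
      using alpha_pos by (simp add: abs_mult mult.assoc flip: right_diff_distrib)
  qed
  show "\<phi> b \<le> \<psi> b" if "\<phi> a \<le> \<psi> a"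
  proof -
    have "w b \<le> 0"
      by (rule nonpos_forward[OF assms(2) w_cont, where L = "\<alpha> * L"])
        (use that w_deriv in \<open>auto simp: w_def[of a] abs_le_iff\<close>)
    then show ?thesis by (simp add: w_def)
  qed
  show "\<phi> a \<le> \<psi> a" if "\<phi> b \<le> \<psi> b"
  proof -
    have "w a \<le> 0"
    proof (rule nonpos_backward[OF assms(2) w_cont, where L = "\<alpha> * L"])
      fix y assume "a < y" "y < b" "0 < w y"
      then obtain d where d: "(w has_real_derivative d) (at y)" "\<bar>d\<bar> \<le> \<alpha> * L * w y"
        using w_deriv by blast
      then show "\<exists>d. (w has_real_derivative d) (at y) \<and> - (\<alpha> * L) * w y \<le> d"
        by (intro exI[of _ d]) (simp add: abs_le_iff)
    qed (use that in \<open>simp add: w_def\<close>)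
    then show ?thesis by (simp add: w_def)
  qed
qed

lemma solution_on_unique:
  assumes sol: "solution_on f \<alpha> J \<phi>" "solution_on f \<alpha> K \<psi>"
    and \<xi>: "0 < \<xi>" "\<xi> \<in> J" "\<xi> \<in> K" "\<phi> \<xi> = \<psi> \<xi>" and y: "y \<in> J" "y \<in> K"
  shows "\<phi> y = \<psi> y"
proof -
  have pos: "\<phi> x = \<psi> x" if x: "0 < x" "x \<in> J" "x \<in> K" for x
  proof (cases "\<xi> \<le> x")
    case True
    note arcs = solution_on_arc[OF sol(1) \<xi>(2) x(2) \<xi>(1)] solution_on_arc[OF sol(2) \<xi>(3) x(3) \<xi>(1)]
    show ?thesis
      using solution_arc_mono(1)[OF \<xi>(1) True arcs] solution_arc_mono(1)[OF \<xi>(1) True arcs(2,1)] \<xi>(4)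
      by simp
  next
    case False
    then have le: "x \<le> \<xi>" by simp
    note arcs = solution_on_arc[OF sol(1) x(2) \<xi>(2) x(1)] solution_on_arc[OF sol(2) x(3) \<xi>(3) x(1)]
    show ?thesis
      using solution_arc_mono(2)[OF x(1) le arcs] solution_arc_mono(2)[OF x(1) le arcs(2,1)] \<xi>(4)
      by simp
  qed
  have "J \<subseteq> {0..}" using sol(1) by (simp add: solution_on_def)
  then have "0 \<le> y" using y(1) by auto
  then consider "0 < y" | "y = 0" by linarith
  then show ?thesis
  proof cases
    case 1
    then show ?thesis using pos y by blast
  next
    case 2
    \<comment> \<open>At 0 the equation says nothing; equality there is carried over by continuity
      from \<open>{0<..\<xi>}\<close>.\<close>
    have sub: "{0..\<xi>} \<subseteq> J" "{0..\<xi>} \<subseteq> K"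
    proof -
      have "is_interval J" "is_interval K" using sol by (simp_all add: solution_on_def)
      then show "{0..\<xi>} \<subseteq> J" "{0..\<xi>} \<subseteq> K"
        using mem_is_interval_1_I[of J 0 \<xi>] mem_is_interval_1_I[of K 0 \<xi>] \<xi>(2,3) y
        unfolding 2 by (simp_all add: subset_iff)
    qed
    have cl: "closure {0<..\<xi>} = {0..\<xi>}" using \<xi>(1) by simp
    have "\<phi> 0 - \<psi> 0 = 0"
    proof (rule continuous_constant_on_closure[where f = "\<lambda>x. \<phi> x - \<psi> x" and S = "{0<..\<xi>}"])
      show "continuous_on (closure {0<..\<xi>}) (\<lambda>x. \<phi> x - \<psi> x)"
        unfolding cl
      proof (rule continuous_on_diff)
        have c: "continuous_on J \<phi>" "continuous_on K \<psi>"
          using sol by (simp_all add: solution_on_def)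
        show "continuous_on {0..\<xi>} \<phi>" "continuous_on {0..\<xi>} \<psi>"
          by (fact continuous_on_subset[OF c(1) sub(1)] continuous_on_subset[OF c(2) sub(2)])+
      qed
      show "\<phi> x - \<psi> x = 0" if "x \<in> {0<..\<xi>}" for x 
          using pos[of x] that subsetD[OF sub(1), of x] subsetD[OF sub(2), of x] by simp
      show "0 \<in> closure {0<..\<xi>}" unfolding cl using \<xi>(1) by simp
    qed
    then show ?thesis using 2 by simp
  qed
qed

text \<open>Uniqueness makes the description by \<open>THE\<close> unambiguous, so any solution
  through the point identifies the maximal one on its own interval.\<close>

lemma maximal_solution_eq:
  assumes "solution_on f \<alpha> J \<phi>" "0 < \<xi>" "\<xi> \<in> J" "y \<in> J"
  shows "maximal_solution f \<alpha> \<xi> (\<phi> \<xi>) y = \<phi> y"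
proof -
  have val: "solution_value f \<alpha> \<xi> (\<phi> \<xi>) y (\<phi> y)"
    using assms by (auto simp: solution_value_def)
  moreover have "v = \<phi> y" if v: "solution_value f \<alpha> \<xi> (\<phi> \<xi>) y v" for v
  proof -
    obtain K \<psi> where "solution_on f \<alpha> K \<psi>" "\<xi> \<in> K" "y \<in> K" "\<psi> \<xi> = \<phi> \<xi>" "\<psi> y = v"
      using v by (auto simp: solution_value_def)
    then show ?thesis using solution_on_unique[OF assms(1), of K \<psi> \<xi> y] assms by simp
  qed
  ultimately have "(THE v. solution_value f \<alpha> \<xi> (\<phi> \<xi>) y v) = \<phi> y" by (rule the_equality)
  then show ?thesis using val by (auto simp: maximal_solution_def)
qed

subsection \<open>From ratios to reserve functions\<close>

text \<open>Inverts \<open>z t = \<phi> (exp t) / exp t\<close>. At 0 the factor \<open>y\<close>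
  makes the value of \<open>ln 0\<close> irrelevant.\<close>

definition lift :: "(real \<Rightarrow> real) \<Rightarrow> real \<Rightarrow> real" where
  "lift z y = y * z (ln y)"

lemma lift_deriv:
  assumes "ratio_solution z" "0 < y" "1 \<le> z (ln y)" "z (ln y) \<le> beta"
  shows "(lift z has_real_derivative \<alpha> * F (lift z y) y) (at y)"
proof -
  have "((\<lambda>y. z (ln y)) has_real_derivative ratio_field (ln y) (z (ln y)) * (1 / y)) (at y)"
    using assms(1,2) unfolding ratio_solution_def
    by (intro DERIV_chain2[where g = ln and f = z] DERIV_ln_divide) auto
  then have "((\<lambda>y. y * z (ln y)) has_real_derivative
      1 * z (ln y) + ratio_field (ln y) (z (ln y)) * (1 / y) * y) (at y)"
    by (intro DERIV_mult DERIV_ident)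
  then show ?thesis
    using assms clip(4)[of "z (ln y)"]
    by (simp add: lift_def[abs_def] ratio_field_def mult.commute)
qed

lemma lift_continuous:
  assumes "ratio_solution z" "J \<subseteq> {0..}" "\<And>y. y \<in> J \<Longrightarrow> 0 < y \<Longrightarrow> 1 \<le> z (ln y) \<and> z (ln y) \<le> beta"
  shows "continuous_on J (lift z)"
  unfolding continuous_on_eq_continuous_within
proof
  fix y assume y: "y \<in> J"
  show "continuous (at y within J) (lift z)"
  proof (cases "y = 0")
    case False
    then have "0 < y" using y assms(2) by auto
    then show ?thesis
      using assms y
      by (intro continuous_at_imp_continuous_at_within[OF DERIV_isCont[OF lift_deriv]]) auto
  next
    case True
    \<comment> \<open>At 0 the equation gives no continuity, but the bounded ratio squeezes the
      values.\<close>
    have "norm (lift z x) \<le> x * beta" if "x \<in> J" for x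
    proof (cases "x = 0")
      case False
      then have "0 < x" using that assms(2) by auto
      then have "0 \<le> z (ln x)" "z (ln x) \<le> beta" using assms(3)[OF that] by auto
      then show ?thesis using \<open>0 < x\<close> by (simp add: lift_def abs_mult mult_left_mono)
    qed (simp add: lift_def)
    then have "\<forall>\<^sub>F x in at 0 within J. norm (lift z x) \<le> x * beta"
      by (simp add: eventually_at_filter)
    moreover have "((\<lambda>x. x * beta) \<longlongrightarrow> 0) (at 0 within J)"
      by (auto intro!: tendsto_eq_intros)
    ultimately have "(lift z \<longlongrightarrow> 0) (at 0 within J)" by (rule Lim_null_comparison)
    then show ?thesis using True by (simp add: continuous_within lift_def)
  qed
qed

lemma lift_competitive:
  assumes "ratio_solution z" "J \<subseteq> {0..}" "\<And>y. y \<in> J \<Longrightarrow> 0 < y \<Longrightarrow> 1 \<le> z (ln y) \<and> z (ln y) \<le> beta"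
  shows "competitive_on f \<alpha> J (lift z)"
  unfolding competitive_on_def
proof (intro conjI ballI impI exI)
  show "lift z 0 = 0" by (simp add: lift_def)
  show "continuous_on J (lift z)" by (rule lift_continuous[OF assms])
  fix y assume y: "y \<in> J" "0 < y"
  show "(lift z has_real_derivative \<alpha> * F (lift z y) y) (at y within J)"
    using assms(3)[OF y] by (intro has_field_derivative_at_within[OF lift_deriv[OF assms(1) y(2)]]) auto
  show le: "y \<le> lift z y" using assms(3)[OF y] y by (simp add: lift_def)
  have "0 \<le> power_field \<sigma> (lift z y / y)" using sigma_gt y le by (intro power_field_bounds) auto
  then show "0 \<le> \<alpha> * F (lift z y) y" using F_bounds(1)[OF y(2) le] alpha_pos by simp
qed simp

lemma lift_solution_on:
  assumes "ratio_solution z" "J \<subseteq> {0..}" "\<And>y. y \<in> J \<Longrightarrow> 0 < y \<Longrightarrow> 1 \<le> z (ln y) \<and> z (ln y) \<le> beta"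
    and "is_interval J"
  shows "solution_on f \<alpha> J (lift z)"
  using lift_competitive[OF assms(1-3)] assms
  by (fastforce simp: competitive_on_def solution_on_def)

lemma competitive_on_cong:
  assumes "competitive_on f a J \<phi>" "0 \<in> J" "\<And>y. y \<in> J \<Longrightarrow> \<phi> y = \<psi> y"
  shows "competitive_on f a J \<psi>"
  unfolding competitive_on_def
proof (intro conjI ballI impI)
  show "\<psi> 0 = 0" "continuous_on J \<psi>"
    using assms continuous_on_cong[OF refl assms(3)] by (auto simp: competitive_on_def)
  fix y assume y: "y \<in> J" "0 < y"
  then show "y \<le> \<psi> y" using assms by (auto simp: competitive_on_def)
  obtain d where d: "(\<phi> has_real_derivative d) (at y within J)" "d = a * F (\<phi> y) y" "0 \<le> d"
    using assms(1) y by (auto simp: competitive_on_def)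
  have "(\<psi> has_real_derivative d) (at y within J)"
    by (rule has_field_derivative_transform_within[OF d(1) zero_less_one y(1)]) (rule assms(3))
  then show "\<exists>d. (\<psi> has_real_derivative d) (at y within J) \<and> d = a * F (\<psi> y) y \<and> 0 \<le> d"
    using d assms(3)[OF y(1)] by auto
qed

lemma competitive_on_subset:
  assumes "competitive_on f a J \<phi>" "K \<subseteq> J"
  shows "competitive_on f a K \<phi>"
  unfolding competitive_on_def
proof (intro conjI ballI impI)
  show "\<phi> 0 = 0" "continuous_on K \<phi>"
    using assms continuous_on_subset[of J \<phi> K] by (simp_all add: competitive_on_def)
  fix y assume y: "y \<in> K" "0 < y"
  then have "y \<in> J" using assms(2) by blast
  then show "y \<le> \<phi> y" using assms y by (simp add: competitive_on_def)
  obtain d where d: "(\<phi> has_real_derivative d) (at y within J)" "d = a * F (\<phi> y) y" "0 \<le> d"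
    using assms(1) y \<open>y \<in> J\<close> by (auto simp: competitive_on_def)
  then show "\<exists>d. (\<phi> has_real_derivative d) (at y within K) \<and> d = a * F (\<phi> y) y \<and> 0 \<le> d"
    using has_field_derivative_subset[OF d(1) assms(2)] by blast
qed

text \<open>The ratio stays in \<open>[1, beta]\<close>: between the fixed barriers before
  \<open>\<xi>\<close>, and afterwards above the moving one, which equals
  \<open>chi * \<xi> / y \<ge> 1\<close>. Clipping therefore has no effect, and
  \<open>lift z\<close> is a genuine solution through \<open>(\<xi>, chi * \<xi>)\<close>.\<close>

lemma phi_lb_from_eq:
  assumes "0 < \<xi>" and z: "ratio_solution z" "z (ln \<xi>) = chi"
  shows "y \<in> {0..chi * \<xi>} \<Longrightarrow> phi_lb_from f \<tau> \<sigma> \<xi> y = lift z y"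
    and "competitive_on f \<alpha> {0..chi * \<xi>} (phi_lb_from f \<tau> \<sigma> \<xi>)"
    and "solution_on f \<alpha> {0..chi * \<xi>} (lift z)"
proof -
  note bar = ratio_solution_barriers[OF z]
  have range: "1 \<le> z (ln y) \<and> z (ln y) \<le> beta" if y: "y \<in> {0..chi * \<xi>}" "0 < y" for y
  proof (cases "y \<le> \<xi>")
    case True
    then show ?thesis using bar(1,2)[of "ln y"] y chi_properties(1) by simp
  next
    case False
    have "ln y \<le> ln (chi * \<xi>)" using y chi_properties(1) assms(1) by simp
    also have "\<dots> = ln \<xi> + ln chi" using chi_properties(1) assms(1) by (simp add: ln_mult)
    finally have "chi * exp (ln \<xi> - ln y) \<le> z (ln y)"
      using False y assms(1) by (intro bar(4)) auto
    moreover have "1 \<le> chi * exp (ln \<xi> - ln y)"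
      using y assms(1) by (simp add: exp_diff field_simps)
    moreover have "z (ln y) \<le> chi" using False y assms(1) by (intro bar(3)) auto
    ultimately show ?thesis using chi_properties(2) by simp
  qed
  have "\<xi> \<in> {0..chi * \<xi>}" using assms(1) chi_properties(1) by simp
  have "{0..chi * \<xi>} \<subseteq> {0..}" by simp
  note competitive = lift_competitive[OF z(1) this range]
    and solution = lift_solution_on[OF z(1) this range]
  show sol: "solution_on f \<alpha> {0..chi * \<xi>} (lift z)"
    by (rule solution) (simp_all add: is_interval_cc)
  have "lift z \<xi> = chi * \<xi>" by (simp add: lift_def z(2))
  then show eq: "phi_lb_from f \<tau> \<sigma> \<xi> y = lift z y" if "y \<in> {0..chi * \<xi>}" for y
    using maximal_solution_eq[OF sol assms(1) \<open>\<xi> \<in> {0..chi * \<xi>}\<close> that] by (simp add: phi_lb_from_def)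
  show "competitive_on f \<alpha> {0..chi * \<xi>} (phi_lb_from f \<tau> \<sigma> \<xi>)"
  proof (rule competitive_on_cong[OF competitive])
    show "0 \<in> {0..chi * \<xi>}" using \<open>\<xi> \<in> {0..chi * \<xi>}\<close> assms(1) by simp
    show "lift z y = phi_lb_from f \<tau> \<sigma> \<xi> y" if "y \<in> {0..chi * \<xi>}" for y
      using eq[OF that] by simp
  qed
qed

subsection \<open>The lower-bound solution\<close>

lemma F_le_power_field:
  assumes "0 < y" "1 \<le> z"
  shows "F (z * y) y \<le> power_field \<tau> z"
  using F_bounds(2)[of y "z * y"] assms by simp

text \<open>Once \<open>\<phi> y / y\<close> drops below the smaller root it decreases at least linearly in \<open>ln y\<close>.\<close>

lemma competitive_ge_chi:
  assumes comp: "competitive_on f \<alpha> {0..} \<phi>" and "0 < y0"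
  shows "chi * y0 \<le> \<phi> y0"
proof (rule ccontr)
  assume "\<not> chi * y0 \<le> \<phi> y0"
  define t0 where "t0 = ln y0"
  define z where "z t = \<phi> (exp t) / exp t" for t
  have \<phi>: "exp t \<le> \<phi> (exp t)" "(\<phi> has_real_derivative \<alpha> * F (\<phi> (exp t)) (exp t)) (at (exp t))" for t
  proof -
    have "exp t \<in> {0..}" "0 < exp t" by auto
    then show "exp t \<le> \<phi> (exp t)"
      using comp by (simp add: competitive_on_def)
    have "solution_arc (exp t / 2) (2 * exp t) \<phi>"
      by (rule competitive_on_arc[OF comp]) simp
    then show "(\<phi> has_real_derivative \<alpha> * F (\<phi> (exp t)) (exp t)) (at (exp t))"
      by (simp add: solution_arc_def)
  qed
  have z_ge: "1 \<le> z t" for t using \<phi>(1)[of t] by (simp add: z_def)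
  have z_deriv: "(z has_real_derivative \<alpha> * F (z t * exp t) (exp t) - z t) (at t)" for t
  proof -
    have "((\<lambda>t. \<phi> (exp t)) has_real_derivative \<alpha> * F (\<phi> (exp t)) (exp t) * exp t) (at t)"
      by (rule DERIV_chain2[where f = \<phi> and g = exp, OF \<phi>(2) DERIV_exp])
    then have "((\<lambda>t. \<phi> (exp t) / exp t) has_real_derivative
        (\<alpha> * F (\<phi> (exp t)) (exp t) * exp t * exp t - \<phi> (exp t) * exp t) / (exp t * exp t)) (at t)"
      by (intro DERIV_divide DERIV_exp) auto
    moreover have "(\<alpha> * F (\<phi> (exp t)) (exp t) * exp t * exp t - \<phi> (exp t) * exp t) / (exp t * exp t)
        = \<alpha> * F (z t * exp t) (exp t) - z t"
      by (simp add: z_def diff_divide_distrib)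
    ultimately show ?thesis by (simp add: z_def[abs_def])
  qed
  have z_le_drift: "\<alpha> * F (z t * exp t) (exp t) - z t \<le> drift (z t)" for t
    using F_le_power_field[OF exp_gt_zero z_ge, of t t] alpha_pos by (simp add: drift_def)
  have z_cont: "continuous_on A z" for A
    by (rule DERIV_continuous_on) (rule has_field_derivative_at_within[OF z_deriv])
  have z0: "z t0 < chi" using \<open>\<not> chi * y0 \<le> \<phi> y0\<close> \<open>0 < y0\<close> by (simp add: z_def t0_def field_simps)
  \<comment> \<open>The level \<open>z t0\<close> is itself a barrier, because \<open>drift\<close>
    is negative there.\<close>
  have stays: "z t \<le> z t0" if "t0 \<le> t" for t
  proof -
    have "z t - z t0 \<le> 0"
    proof (rule nonpos_forward[where L = \<alpha>, OF that])
      show "continuous_on {t0..t} (\<lambda>t. z t - z t0)" by (intro continuous_intros z_cont)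
      fix s assume "0 < z s - z t0"
      then have "\<alpha> * (power_field \<tau> (z s) - power_field \<tau> (z t0)) \<le> \<alpha> * (z s - z t0)"
        using alpha_pos tau_gt z_ge by (intro mult_left_mono power_field_diff_le) auto
      then have "drift (z s) - drift (z t0) \<le> \<alpha> * (z s - z t0)"
        using \<open>0 < z s - z t0\<close> by (simp add: drift_def right_diff_distrib)
      moreover have "drift (z t0) < 0" by (rule drift_neg[OF z_ge z0])
      ultimately have "\<alpha> * F (z s * exp s) (exp s) - z s \<le> \<alpha> * (z s - z t0)"
        using z_le_drift[of s] by linarith
      moreover have "((\<lambda>t. z t - z t0) has_real_derivative \<alpha> * F (z s * exp s) (exp s) - z s) (at s)"
        using DERIV_diff[OF z_deriv[of s] DERIV_const[of "z t0"]] by simp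
      ultimately show "\<exists>d. ((\<lambda>t. z t - z t0) has_real_derivative d) (at s) \<and> d \<le> \<alpha> * (z s - z t0)"
        by blast
    qed simp
    then show ?thesis by simp
  qed
  have "{1..z t0} \<noteq> {}" using z_ge by simp
  then obtain x where x: "x \<in> {1..z t0}" "\<forall>s\<in>{1..z t0}. drift s \<le> drift x"
    using continuous_attains_sup[OF compact_Icc, of 1 "z t0" drift] drift_continuous[of "{1..z t0}"]
    by force
  \<comment> \<open>The maximum of \<open>drift\<close> on \<open>{1..z t0}\<close> is negative
    since the interval ends before \<open>chi\<close>; so the ratio falls at rate at least
    \<open>c\<close>.\<close>
  define c where "c = - drift x"
  have "0 < c" using drift_neg[of x] x(1) z0 by (simp add: c_def)
  \<comment> \<open>When a linear decrease from \<open>z t0\<close> at rate \<open>c\<close> reaches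
    0, contradicting \<open>z T \<ge> 1\<close>.\<close>
  define T where "T = t0 + z t0 / c"
  have "t0 \<le> T" using \<open>0 < c\<close> z_ge[of t0] by (simp add: T_def)
  have "z T + c * T \<le> z t0 + c * t0"
  proof (rule DERIV_nonpos_imp_nonincreasing[OF \<open>t0 \<le> T\<close>], intro exI conjI)
    fix s assume "t0 \<le> s" "s \<le> T"
    show "((\<lambda>s. z s + c * s) has_real_derivative (\<alpha> * F (z s * exp s) (exp s) - z s) + c * 1) (at s)"
      by (intro DERIV_add DERIV_cmult DERIV_ident z_deriv)
    have "drift (z s) \<le> - c"
      using x(2) stays[OF \<open>t0 \<le> s\<close>] z_ge by (simp add: c_def)
    then show "\<alpha> * F (z s * exp s) (exp s) - z s + c * 1 \<le> 0"
      using z_le_drift[of s] by simp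
  qed
  then have "z T \<le> 0" using \<open>0 < c\<close> by (simp add: T_def algebra_simps)
  then show False using z_ge[of T] by simp
qed

text \<open>Near the origin the elasticity of \<open>f'\<close> is close to
  \<open>\<tau> - 1\<close>, so the field is nearly \<open>drift\<close>, which is at least
  \<open>\<kappa> * (z - chi)\<close>. Followed backwards in time, an excess over \<open>chi\<close>
  thus decays exponentially, up to an error \<open>\<delta>\<close>.\<close>

lemma ratio_solution_tendsto_chi:
  assumes z: "ratio_solution z" and range: "\<And>t. chi \<le> z t \<and> z t \<le> beta"
  shows "(z \<longlongrightarrow> chi) at_bot"
proof (rule tendstoI)
  fix e :: real assume "0 < e"
  define \<delta> where "\<delta> = e / 2"
  have "0 < \<delta>" using \<open>0 < e\<close> by (simp add: \<delta>_def)
  obtain \<kappa> where \<kappa>: "0 < \<kappa>" "\<And>x. chi \<le> x \<Longrightarrow> x \<le> beta \<Longrightarrow> \<kappa> * (x - chi) \<le> drift x"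
    by (rule drift_pos_linear) blast
  \<comment> \<open>Chosen so that the error
    \<open>\<alpha> * (\<eta> / (\<tau> - 1)\<^sup>2)\<close> of the field below equals
    \<open>\<kappa> * \<delta>\<close>.\<close>
  define \<eta> where "\<eta> = \<kappa> * \<delta> * (\<tau> - 1)\<^sup>2 / \<alpha>"
  have "0 < \<eta>" using \<kappa>(1) \<open>0 < \<delta>\<close> tau_gt alpha_pos by (simp add: \<eta>_def)
  then have "\<tau> - 1 < \<tau> - 1 + \<eta>" by simp
  then obtain Y where Y: "0 < Y" "\<And>y. 0 < y \<Longrightarrow> y \<le> Y \<Longrightarrow> elasticity g y < \<tau> - 1 + \<eta>"
    by (rule g_elasticity_near_origin) blast
  \<comment> \<open>Before this time \<open>p = z s * exp s\<close> is at most \<open>Y\<close>,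
    since the ratio is at most \<open>beta\<close>.\<close>
  define T where "T = ln (Y / beta)"
  have field: "\<kappa> * (z s - chi - \<delta>) \<le> ratio_field s (z s)" if "s \<le> T" for s
  proof -
    have z1: "1 \<le> z s" "z s \<le> beta" using range[of s] chi_properties(1) by auto
    define p where "p = z s * exp s"
    define E where "E = elasticity g p"
    define P where "P = power_field \<tau> (z s)"
    have "0 < p" using z1 by (simp add: p_def)
    have "exp s \<le> Y / beta"
      using that Y(1) beta_gt by (metis T_def divide_pos_pos exp_le_cancel_iff exp_ln less_trans zero_less_one)
    then have "beta * exp s \<le> Y" using beta_gt by (simp add: field_simps)
    moreover have "p \<le> beta * exp s" using z1 by (simp add: p_def)
    ultimately have "p \<le> Y" by simp
    then have E: "E < \<tau> - 1 + \<eta>" "\<tau> - 1 \<le> E"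
      using Y(2)[OF \<open>0 < p\<close>] g_elasticity(1)[OF \<open>0 < p\<close>] by (auto simp: E_def)
    then have "0 < E" using tau_gt by simp
    have P: "0 \<le> P" "P \<le> 1 / (\<tau> - 1)" using power_field_bounds[OF tau_gt z1(1)] by (auto simp: P_def)
    have "(\<tau> - 1) * P / E \<le> F p (exp s)"
      using F_lower_bound_elasticity[of "exp s" p] z1 by (simp add: p_def P_def E_def)
    moreover have "P - (\<tau> - 1) * P / E \<le> \<eta> / (\<tau> - 1)\<^sup>2"
    proof -
      have "P - (\<tau> - 1) * P / E = P * ((E - (\<tau> - 1)) / E)"
        using \<open>0 < E\<close> by (simp add: field_simps)
      also have "\<dots> \<le> 1 / (\<tau> - 1) * (\<eta> / (\<tau> - 1))"
        using P E tau_gt \<open>0 < E\<close> by (intro mult_mono frac_le) auto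
      finally show ?thesis by (simp add: power2_eq_square)
    qed
    ultimately have "\<alpha> * (P - F p (exp s)) \<le> \<alpha> * (\<eta> / (\<tau> - 1)\<^sup>2)"
      using alpha_pos by (intro mult_left_mono) auto
    also have "\<dots> = \<kappa> * \<delta>" using tau_gt alpha_pos by (simp add: \<eta>_def)
    finally have "\<alpha> * P - \<kappa> * \<delta> \<le> \<alpha> * F p (exp s)" by (simp add: right_diff_distrib)
    moreover have "\<kappa> * (z s - chi) \<le> \<alpha> * P - z s"
      using \<kappa>(2)[of "z s"] range[of s] by (simp add: drift_def P_def)
    ultimately show ?thesis
      using clip(4)[OF z1] by (simp add: ratio_field_def p_def right_diff_distrib)
  qed
  \<comment> \<open>Before this time \<open>beta * exp (\<kappa> * (t - T))\<close> is below
    \<open>\<delta>\<close>.\<close>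
  define N where "N = T + ln (\<delta> / beta) / \<kappa>"
  have "z t - chi < e" if "t \<le> T" "t < N" for t
  proof -
    have "(z t - chi - \<delta>) * exp (- \<kappa> * t) \<le> (z T - chi - \<delta>) * exp (- \<kappa> * T)"
    proof (rule DERIV_nonneg_imp_nondecreasing[OF \<open>t \<le> T\<close>], intro exI conjI)
      fix s assume "t \<le> s" "s \<le> T"
      have "(z has_real_derivative ratio_field s (z s)) (at s)"
        using z by (simp add: ratio_solution_def)
      then show "((\<lambda>s. (z s - chi - \<delta>) * exp (- \<kappa> * s)) has_real_derivative
          (ratio_field s (z s) - \<kappa> * (z s - chi - \<delta>)) * exp (- \<kappa> * s)) (at s)"
        by (auto intro!: derivative_eq_intros simp: algebra_simps)
      show "0 \<le> (ratio_field s (z s) - \<kappa> * (z s - chi - \<delta>)) * exp (- \<kappa> * s)"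
        using field[OF \<open>s \<le> T\<close>] by simp
    qed
    also have "\<dots> \<le> beta * exp (- \<kappa> * T)"
      using range[of T] chi_properties(1) \<open>0 < \<delta>\<close> by (intro mult_right_mono) auto
    finally have "(z t - chi - \<delta>) * exp (- \<kappa> * t) * exp (\<kappa> * t) \<le> beta * exp (- \<kappa> * T) * exp (\<kappa> * t)"
      by (rule mult_right_mono) simp
    then have "z t - chi - \<delta> \<le> beta * exp (\<kappa> * (t - T))"
      by (simp add: mult.assoc algebra_simps flip: exp_add)
    moreover have "beta * exp (\<kappa> * (t - T)) < \<delta>"
    proof -
      have "\<kappa> * (t - T) < ln (\<delta> / beta)"
        using that(2) \<kappa>(1) by (simp add: N_def field_simps)
      then have "exp (\<kappa> * (t - T)) < exp (ln (\<delta> / beta))" by simp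
      then show ?thesis using \<open>0 < \<delta>\<close> beta_gt by (simp add: field_simps)
    qed
    ultimately show ?thesis by (simp add: \<delta>_def)
  qed
  then have "dist (z t) chi < e" if "t \<le> min T (N - 1)" for t
    using that range[of t] by (simp add: dist_real_def)
  then show "\<forall>\<^sub>F t in at_bot. dist (z t) chi < e"
    unfolding eventually_at_bot_linorder by blast
qed

text \<open>The difference quotient of \<open>lift z\<close> at 0 is \<open>z (ln y)\<close>, and
  \<open>ln y\<close> tends to minus infinity.\<close>

lemma lift_deriv_origin:
  assumes "(z \<longlongrightarrow> c) at_bot"
  shows "(lift z has_real_derivative c) (at 0 within {0..})"
proof -
  have "((\<lambda>y. z (ln y)) \<longlongrightarrow> c) (at_right 0)"
    by (rule filterlim_compose[OF assms ln_at_0])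
  moreover have "\<forall>\<^sub>F y in at_right 0. z (ln y) = (lift z y - lift z 0) / (y - 0)"
    unfolding eventually_at_right_field by (intro exI[of _ 1]) (auto simp: lift_def)
  ultimately show ?thesis
    by (auto simp: has_field_derivative_iff at_within_Ici_at_right elim: Lim_transform_eventually)
qed

section \<open>Convergence to the lower-bound solution\<close>

lemma phi_lb_from_approximates:
  assumes "0 < \<epsilon>" "0 < Y"
  shows "\<exists>\<xi>>0. competitive_on f \<alpha> {0..Y} (phi_lb_from f \<tau> \<sigma> \<xi>) \<and>
    (\<forall>y\<in>{0..Y}. \<bar>phi_lb_from f \<tau> \<sigma> \<xi> y - phi_lb f \<tau> \<sigma> y\<bar> < \<epsilon>)"
proof -
  \<comment> \<open>The starting points are \<open>\<xi> = exp (real n)\<close>, that is, time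
    \<open>n\<close>.\<close>
  have "\<exists>z. \<forall>n. ratio_solution (z n) \<and> z n (real n) = chi"
    using ratio_solution_exists by (intro choice) metis
  then obtain zn where zn: "\<And>n. ratio_solution (zn n)" "\<And>n. zn n (real n) = chi" by blast
  have zn_range: "chi \<le> zn n t \<and> zn n t \<le> beta" if "t \<le> real n" for n t
    using ratio_solution_barriers(1,2)[OF zn] that by blast
  \<comment> \<open>Convergence of the values at time 0 is enough:
    \<open>solution_dependence\<close> carries it to every other time.\<close>
  have "seq_compact {chi..beta}" by (simp add: compact_imp_seq_compact)
  then obtain c r where r: "strict_mono (r :: nat \<Rightarrow> nat)" "((\<lambda>n. zn n 0) \<circ> r) \<longlonglongrightarrow> c"
    using zn_range[of 0] by (force elim!: seq_compactE)
  obtain z where z: "ratio_solution z" "z 0 = c" by (rule ratio_solution_exists)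
  define L where "L = ratio_Lipschitz"
  have dep: "\<bar>zn n t - z t\<bar> \<le> exp (L * \<bar>t\<bar>) * \<bar>zn n 0 - c\<bar>" for n t
    using solution_dependence[where h = ratio_field and x = "zn n" and y = z and s = 0 and L = L and t = t]
      zn(1)[of n] z ratio_field_Lipschitz ratio_Lipschitz_pos
    by (simp add: ratio_solution_def L_def)
  have "(\<lambda>n. \<bar>zn (r n) 0 - c\<bar>) \<longlonglongrightarrow> \<bar>c - c\<bar>"
    using r(2) by (intro tendsto_intros) (simp add: o_def)
  then have to_zero: "(\<lambda>n. K * \<bar>zn (r n) 0 - c\<bar>) \<longlonglongrightarrow> 0" for K
    using tendsto_mult_right_zero by force
  have "filterlim (\<lambda>n. real (r n)) at_top sequentially"
    by (rule filterlim_compose[OF filterlim_real_sequentially filterlim_subseq[OF r(1)]])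
  then have r_ge: "\<forall>\<^sub>F n in sequentially. x \<le> real (r n)" for x
    unfolding filterlim_at_top by blast
  have lim: "(\<lambda>n. zn (r n) t) \<longlonglongrightarrow> z t" for t
  proof (rule Lim_transform2[OF tendsto_const])
    have "(\<lambda>n. zn (r n) t - z t) \<longlonglongrightarrow> 0"
      by (rule Lim_null_comparison[OF _ to_zero[of "exp (L * \<bar>t\<bar>)"]]) (simp add: dep)
    then show "(\<lambda>n. z t - zn (r n) t) \<longlonglongrightarrow> 0"
      using tendsto_minus by fastforce
  qed
  have z_range: "chi \<le> z t \<and> z t \<le> beta" for t
  proof
    have ev: "\<forall>\<^sub>F n in sequentially. chi \<le> zn (r n) t \<and> zn (r n) t \<le> beta"
      using r_ge[of t] by eventually_elim (rule zn_range)
    show "chi \<le> z t"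
      by (rule tendsto_lowerbound[OF lim]) (use ev in \<open>auto elim: eventually_mono\<close>)
    show "z t \<le> beta"
      by (rule tendsto_upperbound[OF lim]) (use ev in \<open>auto elim: eventually_mono\<close>)
  qed
  define S where "S = {\<phi>. competitive_on f \<alpha> {0..} \<phi> \<and> (\<phi> has_real_derivative chi) (at 0 within {0..})}"
  have "competitive_on f \<alpha> {0..} (lift z)"
    using z_range chi_properties(1) by (intro lift_competitive[OF z(1)]) (auto intro: order_trans less_imp_le)
  moreover have "(lift z has_real_derivative chi) (at 0 within {0..})"
    by (rule lift_deriv_origin[OF ratio_solution_tendsto_chi[OF z(1) z_range]])
  ultimately have in_S: "lift z \<in> S" by (simp add: S_def)
  note from_eq = phi_lb_from_eq[where \<xi> = "exp (real _)" and z = "zn _", simplified, OF zn]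
  have minimal: "lift z y \<le> \<phi> y" if "\<phi> \<in> S" "0 \<le> y" for \<phi> y
  proof (cases "y = 0")
    case True
    then show ?thesis using that by (simp add: S_def lift_def competitive_on_def)
  next
    case False
    then have "0 < y" using that by simp
    have comp: "competitive_on f \<alpha> {0..} \<phi>" using that by (simp add: S_def)
    \<comment> \<open>At \<open>exp (real n)\<close> every feasible function is at least
      \<open>chi * exp (real n)\<close>, the value of \<open>lift (zn n)\<close> there; backward
      comparison brings the order down to \<open>y\<close>.\<close>
    have below: "lift (zn n) y \<le> \<phi> y" if "ln y \<le> real n" for n
    proof -
      have le: "y \<le> exp (real n)" using that \<open>0 < y\<close> by (metis exp_le_cancel_iff exp_ln)
      also have "\<dots> \<le> chi * exp (real n)" using chi_properties(1) by simp
      finally have "solution_arc y (exp (real n)) (lift (zn n))"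
        using \<open>0 < y\<close> chi_properties(1) by (intro solution_on_arc[OF from_eq(3)]) auto
      moreover have "lift (zn n) (exp (real n)) \<le> \<phi> (exp (real n))"
        using competitive_ge_chi[OF comp, of "exp (real n)"] zn(2) by (simp add: lift_def mult.commute)
      ultimately show ?thesis
        using solution_arc_mono(2)[OF \<open>0 < y\<close> le _ competitive_on_arc[OF comp \<open>0 < y\<close>]] by blast
    qed
    have "(\<lambda>n. lift (zn (r n)) y) \<longlonglongrightarrow> lift z y"
      unfolding lift_def by (intro tendsto_intros lim)
    moreover have "\<forall>\<^sub>F n in sequentially. lift (zn (r n)) y \<le> \<phi> y"
      using r_ge[of "ln y"] by eventually_elim (rule below)
    ultimately show ?thesis by (rule tendsto_upperbound) simp
  qed
  \<comment> \<open>The infimum is a minimum, attained by \<open>lift z\<close> at all points at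
    once.\<close>
  have lb: "phi_lb f \<tau> \<sigma> y = lift z y" if "0 \<le> y" for y
    unfolding phi_lb_def S_def[symmetric]
  proof (rule cInf_eq_minimum)
    show "lift z y \<in> (\<lambda>\<phi>. \<phi> y) ` S" using in_S by (rule imageI)
    show "lift z y \<le> x" if "x \<in> (\<lambda>\<phi>. \<phi> y) ` S" for x
      using that minimal \<open>0 \<le> y\<close> by blast
  qed
  \<comment> \<open>Dependence on initial data is useless as \<open>ln y\<close> tends to minus
    infinity. Below \<open>\<delta>\<close> the bound \<open>beta\<close> on the ratios alone makes
    both functions close.\<close>
  define \<delta> where "\<delta> = min Y (\<epsilon> / (2 * beta))"
  have \<delta>: "0 < \<delta>" "\<delta> \<le> Y" "\<delta> * beta < \<epsilon>"
  proof -
    show "0 < \<delta>" "\<delta> \<le> Y" using assms(1) assms(2) beta_gt by (auto simp: \<delta>_def)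
    have "\<delta> * beta \<le> \<epsilon> / (2 * beta) * beta" using beta_gt by (intro mult_right_mono) (auto simp: \<delta>_def)
    also have "\<dots> < \<epsilon>" using assms(1) beta_gt by simp
    finally show "\<delta> * beta < \<epsilon>" .
  qed
  \<comment> \<open>Bounds \<open>y * exp (L * \<bar>ln y\<bar>)\<close> on
    \<open>[\<delta>, Y]\<close>, making the convergence uniform there.\<close>
  define K where "K = Y * exp (L * max \<bar>ln \<delta>\<bar> \<bar>ln Y\<bar>)"
  have "\<forall>\<^sub>F n in sequentially. K * \<bar>zn (r n) 0 - c\<bar> < \<epsilon>"
    using order_tendstoD(2)[OF to_zero assms(1)] .
  moreover note r_ge[of "ln Y"]
  ultimately have "\<forall>\<^sub>F n in sequentially. K * \<bar>zn (r n) 0 - c\<bar> < \<epsilon> \<and> ln Y \<le> real (r n)"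
    by eventually_elim simp
  then obtain m where m: "K * \<bar>zn (r m) 0 - c\<bar> < \<epsilon>" "ln Y \<le> real (r m)"
    using eventually_happens'[OF sequentially_bot] by blast
  define n where "n = r m"
  have "Y \<le> exp (real n)" using m(2) assms(2) by (metis exp_le_cancel_iff exp_ln n_def)
  also have "\<dots> \<le> chi * exp (real n)" using chi_properties(1) by simp
  finally have Y: "{0..Y} \<subseteq> {0..chi * exp (real n)}" by auto
  show ?thesis
  proof (intro exI[of _ "exp (real n)"] conjI ballI)
    show "competitive_on f \<alpha> {0..Y} (phi_lb_from f \<tau> \<sigma> (exp (real n)))"
      by (rule competitive_on_subset[OF from_eq(2) Y])
    fix y assume y: "y \<in> {0..Y}"
    have "\<bar>lift (zn n) y - lift z y\<bar> < \<epsilon>"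
    proof (cases "y < \<delta>")
      case True
      show ?thesis
      proof (cases "y = 0")
        case False
        then have "0 < y" using y by simp
        then have "ln y \<le> real n" using y m(2) by (auto simp: n_def intro: order_trans[of _ "ln Y"])
        then have "\<bar>zn n (ln y) - z (ln y)\<bar> \<le> beta"
          using zn_range[of "ln y" n] z_range[of "ln y"] chi_properties(1) by (auto simp: abs_le_iff)
        then have "y * \<bar>zn n (ln y) - z (ln y)\<bar> \<le> \<delta> * beta"
          using \<open>0 < y\<close> True by (intro mult_mono) auto
        then show ?thesis using \<delta>(3) \<open>0 < y\<close> by (simp add: lift_def abs_mult flip: right_diff_distrib)
      qed (simp add: lift_def assms(1))
    next
      case False
      then have "0 < y" "y \<le> Y" "\<delta> \<le> y" using y \<delta>(1) by auto
      then have "ln \<delta> \<le> ln y" "ln y \<le> ln Y" using \<delta>(1) by auto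
      then have "\<bar>ln y\<bar> \<le> max \<bar>ln \<delta>\<bar> \<bar>ln Y\<bar>" by linarith
      then have "exp (L * \<bar>ln y\<bar>) \<le> exp (L * max \<bar>ln \<delta>\<bar> \<bar>ln Y\<bar>)"
        using ratio_Lipschitz_pos by (simp add: L_def)
      then have "y * exp (L * \<bar>ln y\<bar>) \<le> K"
        unfolding K_def using \<open>0 < y\<close> \<open>y \<le> Y\<close> by (intro mult_mono) auto
      then have "y * exp (L * \<bar>ln y\<bar>) * \<bar>zn n 0 - c\<bar> \<le> K * \<bar>zn n 0 - c\<bar>"
        by (rule mult_right_mono) simp
      moreover have "y * \<bar>zn n (ln y) - z (ln y)\<bar> \<le> y * (exp (L * \<bar>ln y\<bar>) * \<bar>zn n 0 - c\<bar>)"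
        using \<open>0 < y\<close> by (intro mult_left_mono dep) auto
      ultimately have "y * \<bar>zn n (ln y) - z (ln y)\<bar> < \<epsilon>" using m(1) by (simp add: n_def mult.assoc)
      then show ?thesis using \<open>0 < y\<close> by (simp add: lift_def abs_mult flip: right_diff_distrib)
    qed
    moreover have "phi_lb_from f \<tau> \<sigma> (exp (real n)) y = lift (zn n) y"
      using subsetD[OF Y y] by (intro from_eq(1)) simp
    ultimately show "\<bar>phi_lb_from f \<tau> \<sigma> (exp (real n)) y - phi_lb f \<tau> \<sigma> y\<bar> < \<epsilon>"
      using lb y by simp
  qed simp
qed

end

theorem proposition6:
  fixes f :: "real \<Rightarrow> real" and \<tau> \<sigma> :: real
  assumes "strongly_elastic \<tau> \<sigma> f"
    and "tight_elasticity \<tau> \<sigma> f"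
    and "\<tau> \<le> \<sigma>"
    and "1 < \<sigma>"
  shows "(\<forall>\<epsilon>>0. \<forall>Y>0. \<exists>\<xi>>0.
            competitive_on f (alpha_star \<sigma>) {0..Y} (phi_lb_from f \<tau> \<sigma> \<xi>) \<and>
            (\<forall>y\<in>{0..Y}. \<bar>phi_lb_from f \<tau> \<sigma> \<xi> y - phi_lb f \<tau> \<sigma> y\<bar> < \<epsilon>)) \<and>
         (\<forall>\<xi>>0. \<exists>Y\<ge>chi_minus \<tau> \<sigma> * \<xi>.
            competitive_on f (alpha_star \<sigma>) {0..Y} (phi_lb_from f \<tau> \<sigma> \<xi>))"
proof -
  interpret strong_cost f \<tau> \<sigma>
    by unfold_locales (fact assms)+
  \<comment> \<open>For the second claim the witness is \<open>Y = chi * \<xi>\<close>, for every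
    positive \<open>\<xi>\<close>.\<close>
  have "competitive_on f \<alpha> {0..chi * \<xi>} (phi_lb_from f \<tau> \<sigma> \<xi>)" if "0 < \<xi>" for \<xi>
  proof -
    obtain z where "ratio_solution z" "z (ln \<xi>) = chi" by (rule ratio_solution_exists)
    then show ?thesis by (rule phi_lb_from_eq(2)[OF that])
  qed
  then show ?thesis
    by (intro conjI allI impI phi_lb_from_approximates) (auto intro: exI[of _ "chi * _"])
qed

end
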